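(* For any integer $t \geq 2$, any integer $r$ with $1 \leq r \leq t$, and all integers $n > \frac{400 t^2}{3}$, we have $$\left| D_{r,t}(n) - \frac{\log(2)}{t} V_0(n) + \frac12 B_1\left(\frac rt\right) V_1(n) - \frac{t}{8} B_2\left(\frac rt\right) V_2(n) + \frac{t^3}{192} B_4\left(\frac rt\right) V_4(n) \right| \leq \mathrm{Err}_t(n).$$
   Context: For integers $1 \leq r \leq t$ and $n \geq 1$, $D_{r,t}(n)$ is the total number of parts congruent to $r$ modulo $t$ among all partitions of $n$ into pairwise distinct parts, i.e. $D_{r,t}(n) := \sum_{\lambda} \#\{\lambda_j : \lambda_j \equiv r \pmod t\}$, the sum being over all partitions $\lambda=(\lambda_1,\lambda_2,\dots)$ of $n$ into distinct parts. $B_k(x)$ are the Bernoulli polynomials, $\sum_{k \geq 0} B_k(x) \frac{u^k}{k!} = \frac{u e^{xu}}{e^u - 1}$. Given $n$, put $\eta = \frac{\pi}{\sqrt{12 n}}$ and let $\mathcal{D}_0$ be the vertical segment from $\eta - 10\eta i$ to $\eta + 10 \eta i$, oriented upward. For integers $s \geq 0$, $$V_s(n) := \frac{1}{2\pi\sqrt{2}\, i} \int_{\mathcal{D}_0} z^{s-1} \exp\left( \frac{\pi^2}{12 z} + \left(n + \frac{1}{24}\right) z \right) dz.$$ The error function is $$\mathrm{Err}_t(n) := \frac{14381\, t^5}{n^3} \exp\left(\pi \sqrt{\frac n3}\right) + \frac{945285959087}{t n^4} \exp\left(\pi\sqrt{\frac n3}\right) + 9 n \exp\left( \left( \frac{3\sqrt3}{2\pi}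 + \frac{\pi}{\sqrt{12}} \right) \sqrt{n} \right).$$ *)

theory Defs
  imports
    "HOL-Complex_Analysis.Complex_Analysis"
    "HOL-Computational_Algebra.Formal_Power_Series"
    "HOL-Number_Theory.Cong"
begin

(* A partition of n into pairwise distinct parts is represented by the finite set of its parts. *)
definition distinct_partitions :: "nat \<Rightarrow> nat set set" where
  "distinct_partitions n = {P. finite P \<and> (\<forall>k\<in>P. 0 < k) \<and> (\<Sum>k\<in>P. k) = n}"

lemma finite_distinct_partitions: "finite (distinct_partitions n)"
proof (rule finite_subset)
  show "distinct_partitions n \<subseteq> Pow {..n}"
    by (auto simp: distinct_partitions_def intro: member_le_sum)
qed simp

definition D :: "nat \<Rightarrow> nat \<Rightarrow> nat \<Rightarrow> nat" where
  "D r t n = (\<Sum>P\<in>distinct_partitions n. card {k\<in>P. [k = r] (mod t)})"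

(* The division is the exact one of formal power series: the denominator has subdegree 1,
   as has the numerator; see bernpoly_generating_function. *)
definition bernpoly :: "nat \<Rightarrow> real \<Rightarrow> real" where
  "bernpoly k x = fact k * fps_nth (fps_X * fps_exp x / (fps_exp 1 - 1)) k"

lemma bernpoly_generating_function:
  "Abs_fps (\<lambda>k. bernpoly k x / fact k) * (fps_exp 1 - 1) = fps_X * fps_exp x"
proof -
  let ?E = "fps_exp 1 - 1 :: real fps"
  have nz: "fps_nth ?E 1 \<noteq> 0" by simp
  have sub: "subdegree ?E = 1"
    by (rule subdegreeI) (use nz in auto)
  have "?E \<noteq> 0" using nz by force
  moreover have "fps_X * fps_exp x \<noteq> 0"
    by simp
  moreover have "subdegree ?E \<le> subdegree (fps_X * fps_exp x)"
    unfolding sub by simp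
  ultimately have "?E dvd fps_X * fps_exp x"
    using fps_dvd_iff[of ?E "fps_X * fps_exp x"] by blast
  moreover have "Abs_fps (\<lambda>k. bernpoly k x / fact k) = fps_X * fps_exp x / ?E"
    by (intro fps_ext) (simp add: bernpoly_def)
  ultimately show ?thesis by simp
qed

definition eta :: "nat \<Rightarrow> real" where
  "eta n = pi / sqrt (12 * real n)"

definition D0_path :: "nat \<Rightarrow> real \<Rightarrow> complex" where
  "D0_path n = linepath (Complex (eta n) (- 10 * eta n)) (Complex (eta n) (10 * eta n))"

(* Complex-valued as a contour integral, although its values are real by the conjugation
   symmetry of the segment.  The integer power is needed since s - 1 = -1 for s = 0. *)
definition V :: "nat \<Rightarrow> nat \<Rightarrow> complex" where
  "V s n = 1 / (2 * of_real pi * of_real (sqrt 2) * \<i>) *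
     contour_integral (D0_path n)
       (\<lambda>z. z powi (int s - 1) *
            exp (of_real (pi\<^sup>2) / (12 * z) + (of_nat n + 1 / 24) * z))"

definition Err :: "nat \<Rightarrow> nat \<Rightarrow> real" where
  "Err t n =
     14381 * real t ^ 5 / real n ^ 3 * exp (pi * sqrt (real n / 3))
     + 945285959087 / (real t * real n ^ 4) * exp (pi * sqrt (real n / 3))
     + 9 * real n * exp ((3 * sqrt 3 / (2 * pi) + pi / sqrt 12) * sqrt (real n))"

end

theory Submission
  imports Defs
begin

text \<open>
  The generating function of \<^term>\<open>D r t\<close> is the product of (1 + q^m) over all m, times the sum of
  q^m / (1 + q^m) over m congruent to r modulo t.  With q = exp (-z), the logarithm of the first
  factor is a sum of values of log (1 + exp (-u)) at multiples of z, and the second factor is a sum of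
  values of the Fermi function 1 / (exp u + 1), whose derivatives are polynomials in the function
  itself.  On the arc |Im z| <= Re z = eta both are expanded by the Euler-Maclaurin formula with an
  explicit remainder; because the derivatives of the Fermi function of even positive order vanish at 0, the
  errors have orders z^6 and (t z)^5, and they make up the first term of the error function.
  On the rest of the circle 1 + q^m is compared with 1 + |q|^m, which gains the factor
  exp (- 1 / (10 eta)), enough for the third term.  The tail of the
  integrals defining V over eta <= |Im z| <= 10 eta is negligible as well.
\<close>

subsection \<open>Euler--Maclaurin summation\<close>

text \<open>Both sums sample a function along a ray k w, and one chain of successive derivatives (up
  to sign) serves for both: -Li_2(-exp(-u)), log(1 + exp(-u)), the Fermi function and its
  derivatives. The integral in Euler-Maclaurin is then the value at 0 of the preceding member of the
  chain, which is the origin of pi^2/12 and log 2 in the main terms. The obstacle is that the poles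
  of the Fermi function lie on the imaginary axis. The sector |Im u| <= Re u stays away from them
  and, being a cone, contains all multiples of z as soon as it contains z; this dictates the cut at
  |Im z| = eta. The value eta solves the saddle point equation pi^2/(12 eta^2) = n, so both parts of
  the exponent equal n eta there. The lower bound on n says precisely that t eta < pi/40; this keeps
  |t z| below 1/8 on the central arc and below 1 on the whole segment of \<open>V\<close>. The
  factor 1/sqrt 2 in \<open>V\<close> is exp(-ln 2 / 2), from the constant term of the expansion of
  the logarithm. The coefficient formula is proved for finite products, where it is a finite
  identity, and passes to the limit by dominated convergence.\<close>

lemma bernpoly_recurrence:
  "(\<Sum>j\<le>d. bernpoly j x / fact j / fact (d + 1 - j)) = x ^ d / fact d"
proof -
  \<comment> \<open>The coefficient of degree d + 1 is compared because exp u - 1 starts at degree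
    1, so that j runs only up to d.\<close>
  have "fps_nth (Abs_fps (\<lambda>k. bernpoly k x / fact k) * (fps_exp 1 - 1)) (Suc d)
      = fps_nth (fps_X * fps_exp x) (Suc d)"
    by (simp only: bernpoly_generating_function)
  moreover have "fps_nth (fps_X * fps_exp x) (Suc d) = x ^ d / fact d"
    by (simp only: fps_X_mult_nth) simp
  ultimately have "(\<Sum>j\<in>{0..Suc d}. bernpoly j x / fact j * (fps_exp 1 - 1 :: real fps) $ (Suc d - j)) = x ^ d / fact d"
    by (simp only: fps_mult_nth fps_nth_Abs_fps)
  moreover have "(\<Sum>j\<in>{0..Suc d}. bernpoly j x / fact j * (fps_exp 1 - 1 :: real fps) $ (Suc d - j))
     = (\<Sum>j\<le>d. bernpoly j x / fact j * (fps_exp 1 - 1 :: real fps) $ (Suc d - j))"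
    unfolding atLeast0AtMost sum.atMost_Suc by simp
  moreover have "\<dots> = (\<Sum>j\<le>d. bernpoly j x / fact j / fact (d + 1 - j))"
    by (intro sum.cong refl) (auto simp del: fact_Suc)
  ultimately show ?thesis by simp
qed

text \<open>The recurrence solved for its last term. From degree 3 on the lower values stay
  unexpanded: the bounds and the values at 1 use these equations as linear relations.\<close>

lemma bernpoly_scaled_rec:
  fixes x :: real
  shows "bernpoly 0 x / fact 0 = 1"
    "bernpoly 1 x / fact 1 = x - 1 / 2"
    "bernpoly 2 x / fact 2 = (x ^ 2 - x + 1 / 6) / 2"
    "bernpoly 3 x / fact 3 = x ^ 3 / 6 - 1 / 24
       - bernpoly 1 x / fact 1 / 6 - bernpoly 2 x / fact 2 / 2"
    "bernpoly 4 x / fact 4 = x ^ 4 / 24 - 1 / 120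
       - bernpoly 1 x / fact 1 / 24 - bernpoly 2 x / fact 2 / 6 - bernpoly 3 x / fact 3 / 2"
    "bernpoly 5 x / fact 5 = x ^ 5 / 120 - 1 / 720
       - bernpoly 1 x / fact 1 / 120 - bernpoly 2 x / fact 2 / 24 - bernpoly 3 x / fact 3 / 6
       - bernpoly 4 x / fact 4 / 2"
    "bernpoly 6 x / fact 6 = x ^ 6 / 720 - 1 / 5040
       - bernpoly 1 x / fact 1 / 720 - bernpoly 2 x / fact 2 / 120 - bernpoly 3 x / fact 3 / 24
       - bernpoly 4 x / fact 4 / 6 - bernpoly 5 x / fact 5 / 2"
proof -
  define b where "b j = bernpoly j x / fact j" for j
  have r: "(\<Sum>j\<le>d. b j / fact (d + 1 - j)) = x ^ d / fact d" for d
    unfolding b_def by (rule bernpoly_recurrence)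
  have b0: "b 0 = 1" using r[of 0] by simp
  have b1: "b 1 = x - 1 / 2" using r[of 1] b0 by (simp add: fact_numeral)
  have b2: "b 2 = (x ^ 2 - x + 1 / 6) / 2" using r[of 2] b0 b1
    by (simp add: eval_nat_numeral fact_numeral field_simps)
  have 3: "{..3::nat} = {0,1,2,3}" "{..4::nat} = {0,1,2,3,4}" "{..5::nat} = {0,1,2,3,4,5}"
    "{..6::nat} = {0,1,2,3,4,5,6}" by auto
  have b3: "b 3 = x ^ 3 / 6 - 1 / 24 - b 1 / 6 - b 2 / 2" using r[of 3] b0
    by (simp add: 3 fact_numeral)
  have b4: "b 4 = x ^ 4 / 24 - 1 / 120 - b 1 / 24 - b 2 / 6 - b 3 / 2" using r[of 4] b0
    by (simp add: 3 fact_numeral)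
  have b5: "b 5 = x ^ 5 / 120 - 1 / 720 - b 1 / 120 - b 2 / 24 - b 3 / 6 - b 4 / 2" using r[of 5] b0
    by (simp add: 3 fact_numeral)
  have b6: "b 6 = x ^ 6 / 720 - 1 / 5040 - b 1 / 720 - b 2 / 120 - b 3 / 24 - b 4 / 6 - b 5 / 2"
    using r[of 6] b0 by (simp add: 3 fact_numeral)
  show "bernpoly 0 x / fact 0 = 1"
    "bernpoly 1 x / fact 1 = x - 1 / 2"
    "bernpoly 2 x / fact 2 = (x ^ 2 - x + 1 / 6) / 2"
    "bernpoly 3 x / fact 3 = x ^ 3 / 6 - 1 / 24
       - bernpoly 1 x / fact 1 / 6 - bernpoly 2 x / fact 2 / 2"
    "bernpoly 4 x / fact 4 = x ^ 4 / 24 - 1 / 120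
       - bernpoly 1 x / fact 1 / 24 - bernpoly 2 x / fact 2 / 6 - bernpoly 3 x / fact 3 / 2"
    "bernpoly 5 x / fact 5 = x ^ 5 / 120 - 1 / 720
       - bernpoly 1 x / fact 1 / 120 - bernpoly 2 x / fact 2 / 24 - bernpoly 3 x / fact 3 / 6
       - bernpoly 4 x / fact 4 / 2"
    "bernpoly 6 x / fact 6 = x ^ 6 / 720 - 1 / 5040
       - bernpoly 1 x / fact 1 / 720 - bernpoly 2 x / fact 2 / 120 - bernpoly 3 x / fact 3 / 24
       - bernpoly 4 x / fact 4 / 6 - bernpoly 5 x / fact 5 / 2"
    unfolding b_def[symmetric] by (fact b0 b1 b2 b3 b4 b5 b6)+
qed

text \<open>Degree 2 is bounded by completing the square. Above it, the triangle inequality in the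
  recurrence together with \<open>0 \<le> x ^ k \<le> 1\<close> is sharp enough for the constants
  required later.\<close>

lemma bernpoly_scaled_bounds:
  assumes "0 \<le> x" "x \<le> 1"
  shows "\<bar>bernpoly 1 x / fact 1\<bar> \<le> 1 / 2" "\<bar>bernpoly 2 x / fact 2\<bar> \<le> 1 / 12"
    "\<bar>bernpoly 3 x / fact 3\<bar> \<le> 1 / 4" "\<bar>bernpoly 4 x / fact 4\<bar> \<le> 1 / 5"
    "\<bar>bernpoly 5 x / fact 5\<bar> \<le> 4 / 25"
proof -
  have pw: "0 \<le> x ^ k" "x ^ k \<le> 1" for k using assms by (auto intro: power_le_one)
  show 1: "\<bar>bernpoly 1 x / fact 1\<bar> \<le> 1 / 2"
    unfolding bernpoly_scaled_rec(2) using assms by linarith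
  have "0 \<le> x * (1 - x)" using assms by simp
  hence "x ^ 2 - x \<le> 0" by (simp add: power2_eq_square algebra_simps)
  moreover have "0 \<le> (x - 1 / 2)\<^sup>2" by simp
  hence "x ^ 2 - x \<ge> - (1 / 4)" by (simp add: power2_eq_square algebra_simps)
  ultimately show 2: "\<bar>bernpoly 2 x / fact 2\<bar> \<le> 1 / 12"
    unfolding bernpoly_scaled_rec(3) by (intro abs_leI) (simp_all add: field_simps)
  define b where "b j = bernpoly j x / fact j" for j
  note rec = bernpoly_scaled_rec(4-6)[of x, folded b_def]
  note b12 = 1[folded b_def] 2[folded b_def]
  have 3: "\<bar>b 3\<bar> \<le> 1 / 4"
    using rec(1) b12 pw[of 3] by linarith
  moreover from this have 4: "\<bar>b 4\<bar> \<le> 1 / 5"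
    using rec(2) b12 pw[of 4] by linarith
  moreover from this 3 have "\<bar>b 5\<bar> \<le> 4 / 25"
    using rec(3) b12 pw[of 5] by linarith
  ultimately show "\<bar>bernpoly 3 x / fact 3\<bar> \<le> 1 / 4" "\<bar>bernpoly 4 x / fact 4\<bar> \<le> 1 / 5"
    "\<bar>bernpoly 5 x / fact 5\<bar> \<le> 4 / 25"
    unfolding b_def by auto
qed

lemma bernpoly_scaled_at_1:
  "bernpoly 1 1 / fact 1 = 1 / 2" "bernpoly 2 1 / fact 2 = 1 / 12"
  "bernpoly 3 1 / fact 3 = 0" "bernpoly 4 1 / fact 4 = - 1 / 720"
  "bernpoly 5 1 / fact 5 = 0" "bernpoly 6 1 / fact 6 = 1 / 30240"
proof -
  show 1: "bernpoly 1 1 / fact 1 = 1 / 2"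
    using bernpoly_scaled_rec(2)[of 1] unfolding power_one by linarith
  show 2: "bernpoly 2 1 / fact 2 = 1 / 12"
    unfolding bernpoly_scaled_rec(3) by simp
  show 3: "bernpoly 3 1 / fact 3 = 0"
    unfolding bernpoly_scaled_rec(4) 1 2 by simp
  show 4: "bernpoly 4 1 / fact 4 = - 1 / 720"
    unfolding bernpoly_scaled_rec(5) 1 2 3 by simp
  show 5: "bernpoly 5 1 / fact 5 = 0"
    unfolding bernpoly_scaled_rec(6) 1 2 3 4 by simp
  show 6: "bernpoly 6 1 / fact 6 = 1 / 30240"
    unfolding bernpoly_scaled_rec(7) 1 2 3 4 5 by simp
qed

text \<open>Collecting by \<open>d = i + j - 1\<close> turns the coefficient of
  \<open>F (Suc d) * w ^ Suc d\<close> into the left side of the Bernoulli recurrence, hence into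
  \<open>a ^ d / fact d\<close>. So the Bernoulli weights reproduce a Taylor polynomial
  exactly.\<close>

lemma euler_maclaurin_main_terms:
  fixes F :: "nat \<Rightarrow> complex"
  shows "(\<Sum>j\<le>K. of_real (bernpoly j a / fact j) * w ^ j * (\<Sum>i=1..Suc K - j. F (i + j) * w ^ i / fact i))
       = w * (\<Sum>i\<le>K. F (Suc i) * (of_real a * w) ^ i / fact i)"
proof -
  define b where "b j = bernpoly j a / fact j" for j
  have "(\<Sum>j\<le>K. of_real (b j) * w ^ j * (\<Sum>i=1..Suc K - j. F (i + j) * w ^ i / fact i))
      = (\<Sum>j\<le>K. \<Sum>i=1..Suc K - j. of_real (b j) * F (i + j) * w ^ (i + j) / fact i)"
    by (simp add: sum_distrib_left power_add field_simps)
  also have "\<dots> = (\<Sum>j\<le>K. \<Sum>d=j..K. of_real (b j / fact (Suc d - j)) * (F (Suc d) * w ^ Suc d))"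
  proof (rule sum.cong[OF refl])
    fix j assume "j \<in> {..K}"
    hence jK: "j \<le> K" by simp
    show "(\<Sum>i=1..Suc K - j. of_real (b j) * F (i + j) * w ^ (i + j) / fact i)
        = (\<Sum>d=j..K. of_real (b j / fact (Suc d - j)) * (F (Suc d) * w ^ Suc d))"
      using jK by (intro sum.reindex_bij_witness[of _ "\<lambda>d. Suc d - j" "\<lambda>i. i + j - 1"]) auto
  qed
  also have "\<dots> = (\<Sum>d\<le>K. \<Sum>j\<le>d. of_real (b j / fact (Suc d - j)) * (F (Suc d) * w ^ Suc d))"
    unfolding sum.Sigma[OF finite_atMost ballI[OF finite_atLeastAtMost]] sum.Sigma[OF finite_atMost ballI[OF finite_atMost]]
    by (rule sum.reindex_bij_witness[of _ "\<lambda>(d, j). (j, d)" "\<lambda>(j, d). (d, j)"]) auto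
  also have "\<dots> = (\<Sum>d\<le>K. of_real (\<Sum>j\<le>d. b j / fact (d + 1 - j)) * (F (Suc d) * w ^ Suc d))"
    by (simp add: sum_distrib_right)
  also have "\<dots> = (\<Sum>d\<le>K. of_real (a ^ d / fact d) * (F (Suc d) * w ^ Suc d))"
    unfolding b_def bernpoly_recurrence ..
  also have "\<dots> = w * (\<Sum>i\<le>K. F (Suc i) * (of_real a * w) ^ i / fact i)"
    by (simp add: sum_distrib_left power_mult_distrib mult_ac)
  finally show ?thesis unfolding b_def .
qed

text \<open>In place of a remainder with periodic Bernoulli functions, every term is expanded by
  Taylor's formula at \<open>u\<close>; the polynomial parts cancel by the preceding identity and
  only remainders are left. As \<open>F 0\<close> is an antiderivative of the summand
  \<open>F 1\<close>, the term for j = 0 is the integral over the step.\<close>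

lemma euler_maclaurin_step:
  fixes F :: "nat \<Rightarrow> complex \<Rightarrow> complex" and u w :: complex and a :: real
  defines "S \<equiv> closed_segment u (u + w)"
  assumes deriv: "\<And>i x. i < K + 2 \<Longrightarrow> x \<in> S \<Longrightarrow> (F i has_field_derivative F (Suc i) x) (at x)"
    and bound: "\<And>x. x \<in> S \<Longrightarrow> cmod (F (K + 2) x) \<le> M"
    and a: "0 \<le> a" "a \<le> 1"
  shows "cmod (w * F 1 (u + of_real a * w)
            - (\<Sum>j\<le>K. of_real (bernpoly j a / fact j) * w ^ j * (F j (u + w) - F j u)))
         \<le> M * cmod w ^ (K + 2) * (1 / fact K + (\<Sum>j\<le>K. \<bar>bernpoly j a / fact j\<bar> / fact (Suc K - j)))"
proof -
  define b where "b j = bernpoly j a / fact j" for j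
  have uS: "u \<in> S" and uwS: "u + w \<in> S" by (auto simp: S_def)
  have uaS: "u + of_real a * w \<in> S"
    unfolding S_def closed_segment_def using a
    by (auto intro!: exI[of _ a] simp: scaleR_conv_of_real algebra_simps)
  have cS: "convex S" by (simp add: S_def)
  have M0: "0 \<le> M" by (rule order_trans[OF norm_ge_zero bound[OF uS]])
  \<comment> \<open>The order of expansion decreases with j, so that each \<open>w ^ j * R j\<close>
    has order K + 2 in w and is controlled by the same derivative \<open>F (K + 2)\<close>.\<close>
  define R where "R j = F j (u + w) - (\<Sum>i\<le>Suc K - j. F (i + j) u * w ^ i / fact i)" for j
  have R: "cmod (R j) \<le> M * cmod w ^ (K + 2 - j) / fact (Suc K - j)" if "j \<le> K" for j
  proof -
    have "cmod (F (0 + j) (u + w) - (\<Sum>i\<le>Suc K - j. F (i + j) u * (u + w - u) ^ i / fact i))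
        \<le> M * cmod (u + w - u) ^ Suc (Suc K - j) / fact (Suc K - j)"
    proof (rule complex_Taylor[where f = "\<lambda>i. F (i + j)", OF cS _ _ uS uwS])
      fix i x assume "x \<in> S" "i \<le> Suc K - j"
      thus "(F (i + j) has_field_derivative F (Suc i + j) x) (at x within S)"
        using has_field_derivative_at_within[OF deriv[of "i + j" x]] that by simp
    next
      fix x assume "x \<in> S"
      thus "cmod (F (Suc (Suc K - j) + j) x) \<le> M" using bound[of x] that by simp
    qed
    thus ?thesis using that by (simp add: R_def Suc_diff_le)
  qed
  define Q where "Q = F 1 (u + of_real a * w) - (\<Sum>i\<le>K. F (Suc i) u * (of_real a * w) ^ i / fact i)"
  have Q: "cmod Q \<le> M * cmod w ^ Suc K / fact K"
  proof -
    have "cmod (F (0 + 1) (u + of_real a * w) - (\<Sum>i\<le>K. F (i + 1) u * (u + of_real a * w - u) ^ i / fact i))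
        \<le> M * cmod (u + of_real a * w - u) ^ Suc K / fact K"
    proof (rule complex_Taylor[where f = "\<lambda>i. F (i + 1)", OF cS _ _ uS uaS])
      fix i x assume "x \<in> S" "i \<le> K"
      thus "(F (i + 1) has_field_derivative F (Suc i + 1) x) (at x within S)"
        using has_field_derivative_at_within[OF deriv[of "i + 1" x]] by simp
    next
      fix x assume "x \<in> S"
      thus "cmod (F (Suc K + 1) x) \<le> M" using bound[of x] by simp
    qed
    also have "cmod (u + of_real a * w - u) \<le> 1 * cmod w"
      using a by (simp add: norm_mult mult_left_le_one_le)
    hence "M * cmod (u + of_real a * w - u) ^ Suc K / fact K \<le> M * cmod w ^ Suc K / fact K"
      using M0 by (intro divide_right_mono mult_left_mono power_mono) auto
    finally show ?thesis by (simp add: Q_def)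
  qed
  have split0: "(\<Sum>i\<le>Suc K - j. F (i + j) u * w ^ i / fact i)
      = F j u + (\<Sum>i=1..Suc K - j. F (i + j) u * w ^ i / fact i)" for j
    by (simp add: atMost_atLeast0 sum.atLeast_Suc_atMost)
  have "(\<Sum>j\<le>K. of_real (b j) * w ^ j * (F j (u + w) - F j u))
      = (\<Sum>j\<le>K. of_real (b j) * w ^ j * (\<Sum>i=1..Suc K - j. F (i + j) u * w ^ i / fact i))
        + (\<Sum>j\<le>K. of_real (b j) * w ^ j * R j)"
    unfolding sum.distrib[symmetric] R_def split0 by (intro sum.cong refl) (simp add: algebra_simps)
  also have "(\<Sum>j\<le>K. of_real (b j) * w ^ j * (\<Sum>i=1..Suc K - j. F (i + j) u * w ^ i / fact i))
      = w * (F 1 (u + of_real a * w) - Q)"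
    unfolding b_def Q_def using euler_maclaurin_main_terms[of a w "\<lambda>i. F i u" K] by simp
  finally have eq: "w * F 1 (u + of_real a * w)
            - (\<Sum>j\<le>K. of_real (b j) * w ^ j * (F j (u + w) - F j u))
      = w * Q - (\<Sum>j\<le>K. of_real (b j) * w ^ j * R j)"
    by (simp add: algebra_simps)
  have "cmod (w * Q - (\<Sum>j\<le>K. of_real (b j) * w ^ j * R j))
      \<le> cmod (w * Q) + (\<Sum>j\<le>K. cmod (of_real (b j) * w ^ j * R j))"
    by (rule order_trans[OF norm_triangle_ineq4]) (intro add_left_mono norm_sum)
  also have "cmod (w * Q) \<le> M * cmod w ^ (K + 2) * (1 / fact K)"
    using mult_left_mono[OF Q, of "cmod w"] by (simp add: norm_mult mult_ac)
  also have "(\<Sum>j\<le>K. cmod (of_real (b j) * w ^ j * R j))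
      \<le> (\<Sum>j\<le>K. M * cmod w ^ (K + 2) * (\<bar>b j\<bar> / fact (Suc K - j)))"
  proof (intro sum_mono)
    fix j assume "j \<in> {..K}"
    hence j: "j \<le> K" by simp
    have "cmod (of_real (b j) * w ^ j * R j) = \<bar>b j\<bar> * cmod w ^ j * cmod (R j)"
      by (simp add: norm_mult norm_power)
    also have "\<dots> \<le> \<bar>b j\<bar> * cmod w ^ j * (M * cmod w ^ (K + 2 - j) / fact (Suc K - j))"
      by (intro mult_left_mono R j) auto
    also have "\<dots> = M * (cmod w ^ j * cmod w ^ (K + 2 - j)) * (\<bar>b j\<bar> / fact (Suc K - j))"
      by (simp add: mult_ac)
    also have "cmod w ^ j * cmod w ^ (K + 2 - j) = cmod w ^ (K + 2)"
      using j by (simp flip: power_add)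
    finally show "cmod (of_real (b j) * w ^ j * R j)
        \<le> M * cmod w ^ (K + 2) * (\<bar>b j\<bar> / fact (Suc K - j))" .
  qed
  finally show ?thesis
    using eq unfolding b_def by (simp add: sum_distrib_left distrib_left)
qed

text \<open>The boundary terms telescope, and those at infinity vanish by \<open>lim\<close>, so
  only the ones at 0 survive. The factor \<open>\<kappa> ^ k\<close> turns the accumulated errors
  into a geometric series.\<close>

lemma euler_maclaurin_sum:
  fixes F :: "nat \<Rightarrow> complex \<Rightarrow> complex" and w :: complex and a \<kappa> C :: real
  assumes step: "\<And>k. cmod (w * F 1 (of_nat k * w + of_real a * w)
            - (\<Sum>j\<le>K. of_real (bernpoly j a / fact j) * w ^ j * (F j (of_nat (Suc k) * w) - F j (of_nat k * w))))
         \<le> C * \<kappa> ^ k"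
    and lim: "\<And>j. j \<le> K \<Longrightarrow> (\<lambda>k. F j (of_nat k * w)) \<longlonglongrightarrow> 0"
    and \<kappa>: "0 \<le> \<kappa>" "\<kappa> < 1"
    and sums: "(\<lambda>k. F 1 (of_nat k * w + of_real a * w)) sums s"
  shows "cmod (w * s + (\<Sum>j\<le>K. of_real (bernpoly j a / fact j) * w ^ j * F j 0)) \<le> C / (1 - \<kappa>)"
proof -
  define b where "b j = bernpoly j a / fact j" for j
  define G where "G k = (\<Sum>j\<le>K. of_real (b j) * w ^ j * F j (of_nat k * w))" for k
  have "G \<longlonglongrightarrow> (\<Sum>j\<le>K. of_real (b j) * w ^ j * 0)"
    unfolding G_def by (intro tendsto_intros lim) auto
  hence "G \<longlonglongrightarrow> 0" by simp
  from telescope_sums[OF this]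
  have t: "(\<lambda>k. G (Suc k) - G k) sums (- G 0)" by simp
  have e: "(\<lambda>k. w * F 1 (of_nat k * w + of_real a * w) - (G (Suc k) - G k)) sums (w * s - (- G 0))"
    by (intro sums_diff sums_mult sums t)
  have g: "(\<lambda>k. C * \<kappa> ^ k) sums (C * (1 / (1 - \<kappa>)))"
    using \<kappa> by (intro sums_mult geometric_sums) auto
  have "cmod (\<Sum>k. w * F 1 (of_nat k * w + of_real a * w) - (G (Suc k) - G k)) \<le> (\<Sum>k. C * \<kappa> ^ k)"
  proof (rule norm_suminf_le)
    fix k show "cmod (w * F 1 (of_nat k * w + of_real a * w) - (G (Suc k) - G k)) \<le> C * \<kappa> ^ k"
      using step[of k] unfolding G_def b_def
      by (simp only: sum_subtractf[symmetric] right_diff_distrib)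
  qed (use g in \<open>auto simp: sums_iff\<close>)
  thus ?thesis
    using sums_unique[OF e] sums_unique[OF g] by (simp add: G_def b_def)
qed

subsection \<open>The Fermi function and its antiderivatives\<close>

definition fermi :: "complex \<Rightarrow> complex" where
  "fermi u = 1 / (exp u + 1)"

definition log1p_exp :: "complex \<Rightarrow> complex" where
  "log1p_exp u = Ln (1 + exp (- u))"

(* The term n = 0 is 0, as division by 0 gives 0. *)
definition dilog_exp :: "complex \<Rightarrow> complex" where
  "dilog_exp u = (\<Sum>n. - ((- exp (- u)) ^ n) / of_nat n ^ 2)"

text \<open>The Fermi function f satisfies f' = f^2 - f, so each derivative is a polynomial in f;
  differentiating multiplies the formal derivative by X^2 - X.\<close>

primrec fermi_poly :: "nat \<Rightarrow> complex poly" where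
  "fermi_poly 0 = [:0, 1:]"
| "fermi_poly (Suc i) = pderiv (fermi_poly i) * [:0, -1, 1:]"

definition fermi_deriv :: "nat \<Rightarrow> complex \<Rightarrow> complex" where
  "fermi_deriv i u = poly (fermi_poly i) (fermi u)"

lemma fermi_deriv_0: "fermi_deriv 0 = fermi"
  by (simp add: fermi_deriv_def fun_eq_iff)

lemma poly_fermi_poly_0: "poly (fermi_poly i) 0 = 0"
  by (cases i) auto

lemma has_field_derivative_fermi_deriv:
  assumes "exp u + 1 \<noteq> 0"
  shows "(fermi_deriv i has_field_derivative fermi_deriv (Suc i) u) (at u)"
proof -
  have "(fermi has_field_derivative (- exp u / (exp u + 1)\<^sup>2)) (at u)"
    unfolding fermi_def using assms
    by (auto intro!: derivative_eq_intros simp: power2_eq_square)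
  also have "- exp u / (exp u + 1)\<^sup>2 = (fermi u)\<^sup>2 - fermi u"
  proof -
    define y where "y = exp u + 1"
    have "exp u = y - 1" "y \<noteq> 0" using assms by (auto simp: y_def)
    thus ?thesis by (simp add: fermi_def divide_simps power2_eq_square)
  qed
  finally have "(fermi has_field_derivative ((fermi u)\<^sup>2 - fermi u)) (at u)" .
  from DERIV_chain2[OF poly_DERIV this, of "fermi_poly i"] show ?thesis
    unfolding fermi_deriv_def[abs_def] by (simp add: power2_eq_square algebra_simps)
qed

lemma fermi_poly_values:
  "fermi_poly 1 = [:0, -1, 1:]"
  "fermi_poly 2 = [:0, 1, -3, 2:]"
  "fermi_poly 3 = [:0, -1, 7, -12, 6:]"
  "fermi_poly 4 = [:0, 1, -15, 50, -60, 24:]"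
  "fermi_poly 5 = [:0, -1, 31, -180, 390, -360, 120:]"
  "fermi_poly 6 = [:0, 1, -63, 602, -2100, 3360, -2520, 720:]"
proof -
  show 1: "fermi_poly 1 = [:0, -1, 1:]" by (simp add: pderiv_pCons)
  show 2: "fermi_poly 2 = [:0, 1, -3, 2:]"
    using fermi_poly.simps(2)[of 1] by (simp only: 1) (simp add: pderiv_pCons eval_nat_numeral)
  show 3: "fermi_poly 3 = [:0, -1, 7, -12, 6:]"
    using fermi_poly.simps(2)[of 2] by (simp only: 2) (simp add: pderiv_pCons eval_nat_numeral)
  show 4: "fermi_poly 4 = [:0, 1, -15, 50, -60, 24:]"
    using fermi_poly.simps(2)[of 3] by (simp only: 3) (simp add: pderiv_pCons eval_nat_numeral)
  show 5: "fermi_poly 5 = [:0, -1, 31, -180, 390, -360, 120:]"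
    using fermi_poly.simps(2)[of 4] by (simp only: 4) (simp add: pderiv_pCons eval_nat_numeral)
  show 6: "fermi_poly 6 = [:0, 1, -63, 602, -2100, 3360, -2520, 720:]"
    using fermi_poly.simps(2)[of 5] by (simp only: 5) (simp add: pderiv_pCons eval_nat_numeral)
qed

lemma fermi_deriv_at_0:
  "fermi 0 = 1 / 2" "fermi_deriv 1 0 = - 1 / 4" "fermi_deriv 2 0 = 0"
  "fermi_deriv 3 0 = 1 / 8" "fermi_deriv 4 0 = 0"
proof -
  show f: "fermi 0 = 1 / 2" by (simp add: fermi_def)
  show "fermi_deriv 1 0 = - 1 / 4" "fermi_deriv 2 0 = 0"
    "fermi_deriv 3 0 = 1 / 8" "fermi_deriv 4 0 = 0"
    unfolding fermi_deriv_def fermi_poly_values f by simp_all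
qed

text \<open>For Re u <= pi/2 the sector forces cos (Im u) >= 0, and rotating by
  \<open>cnj (cis (Im u))\<close> gives a number with real part exp (Re u) + cos (Im u). Further out
  exp u dominates, and halving the exponent pays for the subtracted 1.\<close>

lemma norm_exp_add_1_ge:
  assumes "\<bar>Im u\<bar> \<le> Re u"
  shows "exp (Re u / 2) \<le> cmod (exp u + 1)"
proof (cases "Re u \<le> pi / 2")
  case True
  hence c: "0 \<le> cos (Im u)" using assms by (intro cos_ge_zero) auto
  have "exp (Re u / 2) \<le> exp (Re u)" using assms by simp
  also have "\<dots> \<le> exp (Re u) * ((sin (Im u))\<^sup>2 + (cos (Im u))\<^sup>2) + cos (Im u)"
    using c by simp
  also have "\<dots> = Re (exp u + 1) * cos (Im u) + Im (exp u + 1) * sin (Im u)"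
    by (simp only: Re_exp Im_exp plus_complex.sel one_complex.sel power2_eq_square) algebra
  also have "\<dots> = Re ((exp u + 1) * cnj (cis (Im u)))"
    by simp
  also have "\<dots> \<le> cmod ((exp u + 1) * cnj (cis (Im u)))"
    by (rule complex_Re_le_cmod)
  finally show ?thesis by (simp add: norm_mult)
next
  case False
  define y where "y = exp (Re u / 2)"
  have "y \<ge> 1 + Re u / 2" unfolding y_def by (rule exp_ge_add_one_self)
  \<comment> \<open>17/10 lies above the golden ratio, from where on y + 1 <= y^2 holds, and below 1
    + pi/4.\<close>
  with False pi_gt3 have y: "y \<ge> 17 / 10" by simp
  have "y + 1 \<le> 17 / 10 * y" using y by simp
  also have "\<dots> \<le> y * y" using y by (intro mult_right_mono) auto
  also have "y * y = cmod (exp u)" by (simp add: y_def flip: exp_add)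
  finally have "y \<le> cmod (exp u) - 1" by simp
  also have "\<dots> \<le> cmod (exp u + 1)"
    using norm_diff_ineq[of "exp u" 1] by simp
  finally show ?thesis by (simp add: y_def)
qed

lemma exp_add_1_nonzero:
  assumes "\<bar>Im u\<bar> \<le> Re u"
  shows "exp u + 1 \<noteq> 0"
  using norm_exp_add_1_ge[OF assms] by (metis exp_gt_zero norm_zero not_le)

lemma norm_fermi_le:
  assumes "\<bar>Im u\<bar> \<le> Re u"
  shows "cmod (fermi u) \<le> exp (- (Re u / 2))"
proof -
  have "cmod (fermi u) = 1 / cmod (exp u + 1)" by (simp add: fermi_def norm_divide)
  also have "\<dots> \<le> 1 / exp (Re u / 2)"
    using norm_exp_add_1_ge[OF assms] by (intro divide_left_mono mult_pos_pos) (auto intro: less_le_trans)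
  finally show ?thesis by (simp add: exp_minus field_simps)
qed

text \<open>One factor f is split off and keeps the exponential decay. In the rest, written in
  Horner form, |f| <= 1 allows the absolute values of the coefficients to be added; they sum to
  9366.\<close>

lemma norm_fermi_deriv_6_le:
  assumes "\<bar>Im u\<bar> \<le> Re u"
  shows "cmod (fermi_deriv 6 u) \<le> 9366 * exp (- (Re u / 2))"
proof -
  define f where "f = fermi u"
  have f: "cmod f \<le> exp (- (Re u / 2))" unfolding f_def by (rule norm_fermi_le[OF assms])
  also have "\<dots> \<le> 1" using assms by simp
  finally have f1: "cmod f \<le> 1" .
  have step: "cmod (c + f * p) \<le> cmod c + B" if "cmod p \<le> B" for c p B
  proof -
    have "cmod (c + f * p) \<le> cmod c + cmod f * cmod p"
      by (metis norm_mult norm_triangle_ineq)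
    also have "cmod f * cmod p \<le> 1 * cmod p" using f1 by (intro mult_right_mono) auto
    finally show ?thesis using that by simp
  qed
  have "cmod (1 + f * (-63 + f * (602 + f * (-2100 + f * (3360 + f * (-2520 + f * 720))))))
      \<le> cmod 1 + (cmod (-63) + (cmod 602 + (cmod (-2100) + (cmod 3360 + (cmod (-2520) + cmod 720)))))"
    (is "cmod ?P \<le> _")
    by (rule step)+ simp
  hence "cmod ?P \<le> 9366" by simp
  moreover have "fermi_deriv 6 u = f * ?P"
    by (simp add: fermi_deriv_def fermi_poly_values f_def)
  ultimately have "cmod (fermi_deriv 6 u) \<le> exp (- (Re u / 2)) * 9366"
    using f by (simp add: norm_mult mult_mono)
  thus ?thesis by (simp add: mult.commute)
qed

text \<open>Keeps the argument of the principal \<open>Ln\<close> off its cut on the closed sector,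
  including the vertex u = 0.\<close>

lemma Re_one_plus_exp_pos:
  assumes "\<bar>Im u\<bar> \<le> Re u"
  shows "Re (1 + exp (- u)) > 0"
proof (cases "Re u = 0")
  case True
  hence "u = 0" using assms by (simp add: complex_eq_iff)
  thus ?thesis by simp
next
  case False
  hence "cmod (exp (- u)) < 1" using assms by simp
  hence "\<bar>Re (exp (- u))\<bar> < 1" by (rule le_less_trans[OF abs_Re_le_cmod])
  thus ?thesis by simp
qed

lemma has_field_derivative_log1p_exp:
  assumes "\<bar>Im u\<bar> \<le> Re u"
  shows "(log1p_exp has_field_derivative - fermi u) (at u)"
proof -
  have "1 + exp (- u) \<notin> \<real>\<^sub>\<le>\<^sub>0"
    using Re_one_plus_exp_pos[OF assms] by (auto simp: complex_nonpos_Reals_iff)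
  hence "(log1p_exp has_field_derivative - exp (- u) / (1 + exp (- u))) (at u)"
    unfolding log1p_exp_def by (auto intro!: derivative_eq_intros simp: divide_inverse mult.commute)
  also have "- exp (- u) / (1 + exp (- u)) = - fermi u"
    using exp_add_1_nonzero[OF assms] by (simp add: fermi_def exp_minus field_simps)
  finally show ?thesis .
qed

lemma log1p_exp_0: "log1p_exp 0 = of_real (ln 2)"
  using Ln_of_real[of 2] by (simp add: log1p_exp_def)

text \<open>The series is -Li_2(-q). Continuity up to the unit circle matters because the expansion
  point u = 0 corresponds to q = 1, outside the open disc of termwise differentiation; the majorant
  1/n^2 makes convergence uniform.\<close>

lemma continuous_on_dilog_series:
  "continuous_on (cball 0 1) (\<lambda>q :: complex. \<Sum>n. - ((- q) ^ n) / of_nat n ^ 2)"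
proof (rule uniform_limit_theorem)
  show "\<forall>\<^sub>F n in sequentially. continuous_on (cball 0 1) (\<lambda>q :: complex. \<Sum>i<n. - ((- q) ^ i) / of_nat i ^ 2)"
    unfolding divide_inverse by (intro always_eventually allI continuous_intros)
  show "uniform_limit (cball 0 1) (\<lambda>n q. \<Sum>i<n. - ((- q) ^ i) / of_nat i ^ 2)
     (\<lambda>q :: complex. \<Sum>n. - ((- q) ^ n) / of_nat n ^ 2) sequentially"
  proof (rule Weierstrass_m_test)
    show "norm (- ((- q) ^ n) / of_nat n ^ 2) \<le> 1 / real n ^ 2" if "q \<in> cball 0 1" for n and q :: complex
      using that by (auto simp: norm_divide norm_power intro!: divide_right_mono power_le_one)
    show "summable (\<lambda>n. 1 / real n ^ 2)"
      using inverse_power_summable[of 2, where ?'a = real] by (simp add: inverse_eq_divide)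
  qed
qed simp

lemma continuous_on_dilog_exp: "continuous_on {u. 0 \<le> Re u} dilog_exp"
  unfolding dilog_exp_def
  by (rule continuous_on_compose2[OF continuous_on_dilog_series]) (auto intro!: continuous_intros)

text \<open>Termwise differentiation in q gives the series of log(1 + q)/q, and the inner derivative
  -q of q = exp(-u) removes the denominator.\<close>

lemma has_field_derivative_dilog_exp:
  assumes "Re u > 0"
  shows "(dilog_exp has_field_derivative - log1p_exp u) (at u)"
proof -
  define c :: "nat \<Rightarrow> complex" where "c n = - ((- 1) ^ n) / of_nat n ^ 2" for n
  define g where "g q = (\<Sum>n. c n * q ^ n)" for q
  have c: "- ((- q) ^ n) / of_nat n ^ 2 = c n * q ^ n" for q n
    by (simp add: c_def power_minus[of q])
  have sm: "summable (\<lambda>n. c n * 1 ^ n)"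
  proof (rule summable_comparison_test')
    show "summable (\<lambda>n. 1 / real n ^ 2)"
      using inverse_power_summable[of 2, where ?'a = real] by (simp add: inverse_eq_divide)
    show "norm (c n * 1 ^ n) \<le> 1 / real n ^ 2" for n
      by (simp add: c_def norm_divide norm_power)
  qed
  define q where "q = exp (- u)"
  have q: "norm q < norm (1 :: complex)" using assms by (simp add: q_def)
  have "(g has_field_derivative (\<Sum>n. diffs c n * q ^ n)) (at q)"
    unfolding g_def by (rule termdiffs_strong[OF sm q])
  have "((\<lambda>u. g (exp (- u))) has_field_derivative (\<Sum>n. diffs c n * q ^ n) * (- exp (- u))) (at u)"
    by (rule DERIV_chain2[where f = g])
       (use \<open>(g has_field_derivative _) _\<close> in \<open>auto simp: q_def intro!: derivative_eq_intros\<close>)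
  moreover have "q * (\<Sum>n. diffs c n * q ^ n) = log1p_exp u"
  proof -
    have "(\<lambda>n. - ((-q) ^ n) / of_nat n) sums ln (1 + q)"
      using q by (intro Ln_series') simp
    hence "(\<lambda>n. - ((-q) ^ Suc n) / of_nat (Suc n)) sums ln (1 + q)"
      by (subst sums_Suc_iff) simp
    moreover have "- ((-q) ^ Suc n) / of_nat (Suc n) = q * (diffs c n * q ^ n)" for n
    proof -
      have "diffs c n = (- 1) ^ n / of_nat (Suc n)"
        unfolding diffs_def c_def by (simp add: power2_eq_square field_simps del: of_nat_Suc)
      thus ?thesis by (simp add: power_minus[of q] del: of_nat_Suc)
    qed
    ultimately have s: "(\<lambda>n. q * (diffs c n * q ^ n)) sums ln (1 + q)" by simp
    have "q \<noteq> 0" by (simp add: q_def)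
    hence "summable (\<lambda>n. diffs c n * q ^ n)"
      using sums_summable[OF s] by (simp add: summable_cmult_iff)
    thus ?thesis using sums_unique[OF s] by (simp add: suminf_mult log1p_exp_def q_def)
  qed
  ultimately show ?thesis
    unfolding dilog_exp_def[abs_def] c g_def q_def by (simp add: mult.commute)
qed

text \<open>The alternating sum of 1/n^2 is zeta(2) minus twice its even part, and the even part is
  a quarter of zeta(2).\<close>

lemma dilog_exp_0: "dilog_exp 0 = of_real (pi\<^sup>2 / 12)"
proof -
  have "(\<lambda>n. 1 / real (Suc n) ^ 2) sums (pi\<^sup>2 / 6)"
    using inverse_squares_sums by simp
  hence s: "(\<lambda>n. 1 / real n ^ 2) sums (pi\<^sup>2 / 6)"
    by (subst (asm) sums_Suc_iff) simp
  hence "(\<lambda>n. 1 / real n ^ 2 / 4) sums (pi\<^sup>2 / 6 / 4)"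
    by (rule sums_divide)
  also have "(\<lambda>n. 1 / real n ^ 2 / 4) = (\<lambda>n. if even (2 * n) then 1 / real (2 * n) ^ 2 else 0)"
    by (simp add: power_mult_distrib mult.commute)
  also have "\<dots> sums (pi\<^sup>2 / 6 / 4) \<longleftrightarrow> (\<lambda>n. if even n then 1 / real n ^ 2 else 0) sums (pi\<^sup>2 / 6 / 4)"
    by (intro sums_mono_reindex[where g = "\<lambda>n. 2 * n"]) (auto simp: strict_mono_def)
  finally have "(\<lambda>n. if even n then 1 / real n ^ 2 else 0) sums (pi\<^sup>2 / 6 / 4)" .
  from sums_diff[OF s sums_mult[OF this, of 2]]
  have "(\<lambda>n. 1 / real n ^ 2 - 2 * (if even n then 1 / real n ^ 2 else 0)) sums (pi\<^sup>2 / 12)"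
    by simp
  also have "(\<lambda>n. 1 / real n ^ 2 - 2 * (if even n then 1 / real n ^ 2 else 0)) = (\<lambda>n. - ((- 1) ^ n) / real n ^ 2)"
    by (auto simp: fun_eq_iff)
  finally have "(\<lambda>n. complex_of_real (- ((- 1) ^ n) / real n ^ 2)) sums of_real (pi\<^sup>2 / 12)"
    by (rule sums_of_real)
  thus ?thesis unfolding dilog_exp_def by (simp add: sums_iff)
qed

section \<open>Decay of the chain of functions along the multiples of a point in the right half
  plane\<close>

context
  fixes w :: complex
  assumes w: "Re w > 0"
begin

lemma tendsto_exp_minus_multiples: "(\<lambda>k. exp (- (of_nat k * w))) \<longlonglongrightarrow> 0"
proof -
  have "(\<lambda>k. exp (- w) ^ k) \<longlonglongrightarrow> 0" using w by (intro LIMSEQ_power_zero) simp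
  thus ?thesis by (simp flip: exp_of_nat_mult)
qed

lemma tendsto_log1p_exp_multiples: "(\<lambda>k. log1p_exp (of_nat k * w)) \<longlonglongrightarrow> 0"
proof -
  have "(\<lambda>k. Ln (1 + exp (- (of_nat k * w)))) \<longlonglongrightarrow> Ln (1 + 0)"
    by (intro tendsto_intros tendsto_exp_minus_multiples) auto
  thus ?thesis by (simp add: log1p_exp_def)
qed

lemma tendsto_dilog_exp_multiples: "(\<lambda>k. dilog_exp (of_nat k * w)) \<longlonglongrightarrow> 0"
proof -
  have "(\<lambda>k. (\<Sum>n. - ((- exp (- (of_nat k * w))) ^ n) / of_nat n ^ 2)) \<longlonglongrightarrow> (\<Sum>n. - ((- 0) ^ n) / of_nat n ^ 2)"
    by (rule continuous_on_tendsto_compose[OF continuous_on_dilog_series tendsto_exp_minus_multiples])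
       (use w in auto)
  moreover have "(\<Sum>n. - ((- 0) ^ n) / of_nat n ^ 2) = (0 :: complex)"
  proof -
    have "(\<lambda>n. - ((- 0) ^ n) / of_nat n ^ 2) = (\<lambda>n. 0 :: complex)"
      by (simp add: fun_eq_iff power_0_left)
    thus ?thesis by simp
  qed
  ultimately show ?thesis by (simp add: dilog_exp_def)
qed

lemma tendsto_fermi_deriv_multiples: "(\<lambda>k. fermi_deriv i (of_nat k * w)) \<longlonglongrightarrow> 0"
proof -
  have "(\<lambda>k. exp (- (of_nat k * w)) / (1 + exp (- (of_nat k * w)))) \<longlonglongrightarrow> 0 / (1 + 0)"
    by (intro tendsto_intros tendsto_exp_minus_multiples) auto
  also have "(\<lambda>k. exp (- (of_nat k * w)) / (1 + exp (- (of_nat k * w)))) = (\<lambda>k. fermi (of_nat k * w))"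
    by (auto simp: fermi_def exp_minus fun_eq_iff divide_simps)
  finally have "(\<lambda>k. fermi (of_nat k * w)) \<longlonglongrightarrow> 0" by simp
  hence "(\<lambda>k. poly (fermi_poly i) (fermi (of_nat k * w))) \<longlonglongrightarrow> poly (fermi_poly i) 0"
    by (rule tendsto_poly)
  thus ?thesis by (simp add: fermi_deriv_def poly_fermi_poly_0)
qed

end

subsection \<open>Expansions near the saddle point\<close>

definition fermi_sum :: "real \<Rightarrow> complex \<Rightarrow> complex" where
  "fermi_sum a w = (\<Sum>k. fermi (of_nat k * w + of_real a * w))"

definition log_xi :: "complex \<Rightarrow> complex" where
  "log_xi z = (\<Sum>k. log1p_exp (of_nat k * z + z))"

text \<open>Minus the Euler-Maclaurin sum at 0, divided by w. The antiderivative -log(1 + exp(-u)),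
  the Fermi function and its first four derivatives take the values -ln 2, 1/2, -1/4, 0, 1/8, 0 at
  0, so the indices 3 and 5 drop out.\<close>

definition fermi_main :: "real \<Rightarrow> complex \<Rightarrow> complex" where
  "fermi_main a w = of_real (ln 2) / w - of_real (bernpoly 1 a / fact 1) / 2
     + of_real (bernpoly 2 a / fact 2) * w / 4 - of_real (bernpoly 4 a / fact 4) * w ^ 3 / 8"

lemma sum_atMost_5: "(\<Sum>j\<le>5 :: nat. f j) = f 0 + f 1 + f 2 + f 3 + f 4 + (f 5 :: 'a :: comm_monoid_add)"
  by (simp add: eval_nat_numeral)

lemma sum_atMost_6: "(\<Sum>j\<le>6 :: nat. f j) = f 0 + f 1 + f 2 + f 3 + f 4 + f 5 + (f 6 :: 'a :: comm_monoid_add)"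
  by (simp add: eval_nat_numeral)

lemma sums_log_xi:
  assumes "Re z > 0"
  shows "(\<lambda>k. log1p_exp (of_nat k * z + z)) sums log_xi z"
proof -
  have "summable (\<lambda>k. log1p_exp (of_nat k * z + z))"
  proof (rule summable_comparison_test_ev)
    have "(\<lambda>k. exp (- (of_nat k * z)) * exp (- z)) \<longlonglongrightarrow> 0 * exp (- z)"
      by (intro tendsto_intros tendsto_exp_minus_multiples assms)
    hence "(\<lambda>k. exp (- (of_nat k * z + z))) \<longlonglongrightarrow> 0"
      by (simp add: exp_add exp_diff exp_minus divide_inverse)
    hence "\<forall>\<^sub>F k in sequentially. norm (exp (- (of_nat k * z + z))) < 1 / 2"
      using order_tendstoD(2)[OF tendsto_norm, of _ 0 sequentially "1/2"] by fastforce
    thus "\<forall>\<^sub>F k in sequentially. norm (log1p_exp (of_nat k * z + z)) \<le> 2 * exp (- Re z) ^ k"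
    proof eventually_elim
      case (elim k)
      have "norm (log1p_exp (of_nat k * z + z)) \<le> 2 * norm (exp (- (of_nat k * z + z)))"
        unfolding log1p_exp_def using elim by (intro norm_Ln_le) simp
      also have "norm (exp (- (of_nat k * z + z))) = exp (real k * - Re z + - Re z)"
        by (simp add: algebra_simps)
      also have "\<dots> \<le> exp (real k * - Re z)" using assms by simp
      also have "\<dots> = exp (- Re z) ^ k" by (rule exp_of_nat_mult)
      finally show ?case by simp
    qed
    show "summable (\<lambda>k. 2 * exp (- Re z) ^ k)"
      using assms by (intro summable_mult summable_geometric) auto
  qed
  thus ?thesis unfolding log_xi_def by (rule summable_sums)
qed

section \<open>Expansions on the sector with explicit constants\<close>

context
  fixes w :: complex
  assumes w: "0 < Re w" "\<bar>Im w\<bar> \<le> Re w"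
begin

lemma sector_segment:
  assumes "x \<in> closed_segment (of_real s * w) (of_real s * w + w)" "0 \<le> s"
  shows "\<bar>Im x\<bar> \<le> Re x" "s * Re w \<le> Re x"
proof -
  from assms obtain v where v: "0 \<le> v" "v \<le> 1"
      "x = (1 - v) *\<^sub>R (of_real s * w) + v *\<^sub>R (of_real s * w + w)"
    by (auto simp: closed_segment_def)
  have x: "x = of_real (s + v) * w" using v(3) by (simp add: scaleR_conv_of_real algebra_simps)
  have "\<bar>(s + v) * Im w\<bar> = (s + v) * \<bar>Im w\<bar>" using v(1) assms(2) by (simp add: abs_mult)
  also have "\<dots> \<le> (s + v) * Re w" using v(1) assms(2) w by (intro mult_left_mono) auto
  finally show "\<bar>Im x\<bar> \<le> Re x" by (simp add: x)
  show "s * Re w \<le> Re x" using v(1) w by (simp add: x algebra_simps)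
qed

lemma Re_sector_ge: "7 / 10 * cmod w \<le> Re w"
proof (rule power2_le_imp_le)
  \<comment> \<open>7/10 is 1/sqrt 2 rounded down; its square 49/100 stays below 1/2.\<close>
  have key: "49 / 100 * (A + B) \<le> A" if "B \<le> A" "0 \<le> A" for A B :: real
    using that by (simp add: distrib_left)
  have "(Im w)\<^sup>2 \<le> (Re w)\<^sup>2" using w by (simp add: abs_le_square_iff[symmetric])
  from key[OF this] show "(7 / 10 * cmod w)\<^sup>2 \<le> (Re w)\<^sup>2"
    by (simp add: power_mult_distrib cmod_power2 power_divide)
qed (use w in auto)

text \<open>Summation over the multiples of w thus costs one factor 1/|w|. With x = Re w / 2 one has
  1 - exp(-x) >= x/(1 + x) >= 16/17 x and x >= 7/20 |w|, and 16/17 times 7/20 exceeds 25/76.\<close>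

lemma geometric_denominator_bound:
  assumes "cmod w \<le> 1 / 8"
  shows "1 / (1 - exp (- (Re w / 2))) \<le> 76 / (25 * cmod w)"
proof -
  have w0: "cmod w > 0" using w by auto
  define x where "x = Re w / 2"
  have x: "0 < x" "x \<le> 1 / 16" "7 / 20 * cmod w \<le> x"
    using w Re_sector_ge assms complex_Re_le_cmod[of w] by (auto simp: x_def)
  have "exp (- x) \<le> 1 / (1 + x)"
    using exp_ge_add_one_self[of x] x by (simp add: exp_minus field_simps)
  also have "\<dots> = 1 - x / (1 + x)" using x by (simp add: field_simps)
  finally have "x / (1 + x) \<le> 1 - exp (- x)" by simp
  moreover have "16 / 17 * x \<le> x / (1 + x)"
    using divide_left_mono[of "1 + x" "17 / 16" x] x by simp
  ultimately have "16 / 17 * x \<le> 1 - exp (- x)" by (rule order_trans[rotated])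
  hence "25 / 76 * cmod w \<le> 1 - exp (- x)" using x by linarith
  hence "1 / (1 - exp (- x)) \<le> 1 / (25 / 76 * cmod w)"
    using w0 x(1) by (intro divide_left_mono mult_pos_pos) auto
  thus ?thesis by (simp add: x_def)
qed

lemma sums_fermi_sum:
  assumes "0 \<le> a"
  shows "(\<lambda>k. fermi (of_nat k * w + of_real a * w)) sums fermi_sum a w"
proof -
  have "summable (\<lambda>k. fermi (of_nat k * w + of_real a * w))"
  proof (rule summable_comparison_test')
    show "summable (\<lambda>k. exp (- (Re w / 2)) ^ k)"
      using w by (intro summable_geometric) auto
    fix k :: nat
    have eq: "of_nat k * w + of_real a * w = of_real (real k + a) * w" by (simp add: algebra_simps)
    have "of_real (real k + a) * w \<in> closed_segment (of_real (real k + a) * w) (of_real (real k + a) * w + w)"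
      by simp
    note sec = sector_segment[OF this]
    have "cmod (fermi (of_nat k * w + of_real a * w)) \<le> exp (- (Re (of_real (real k + a) * w) / 2))"
      unfolding eq using assms by (intro norm_fermi_le sec) auto
    also have "\<dots> \<le> exp (real k * - (Re w / 2))"
      using assms w by (simp add: algebra_simps)
    also have "\<dots> = exp (- (Re w / 2)) ^ k" by (rule exp_of_nat_mult)
    finally show "cmod (fermi (of_nat k * w + of_real a * w)) \<le> exp (- (Re w / 2)) ^ k" .
  qed
  thus ?thesis unfolding fermi_sum_def by (rule summable_sums)
qed

text \<open>Euler-Maclaurin with K = 5 leaves |w|^7 per step; one power goes into the geometric
  series and one into the division by w.\<close>

lemma fermi_sum_expansion:
  assumes "cmod w \<le> 1 / 8" "0 \<le> a" "a \<le> 1"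
  shows "cmod (fermi_sum a w - fermi_main a w) \<le> 9200 * cmod w ^ 5"
proof -
  have w0: "cmod w > 0" "w \<noteq> 0" using w by auto
  define b where "b j = bernpoly j a / fact j" for j
  define F where "F i u = (case i of 0 \<Rightarrow> - log1p_exp u | Suc j \<Rightarrow> fermi_deriv j u)" for i u
  define \<kappa> where "\<kappa> = exp (- (Re w / 2))"
  define c where "c = (1 / fact 5 + (\<Sum>j\<le>5. \<bar>b j\<bar> / fact (Suc 5 - j)))"
  have c: "c \<le> 8 / 25"
    using bernpoly_scaled_bounds[OF assms(2,3), folded b_def] bernpoly_scaled_rec(1)[of a, folded b_def]
    by (simp add: c_def sum_atMost_5 fact_numeral del: One_nat_def)
  have step: "cmod (w * F 1 (of_nat k * w + of_real a * w)
       - (\<Sum>j\<le>5. of_real (b j) * w ^ j * (F j (of_nat (Suc k) * w) - F j (of_nat k * w))))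
       \<le> (9366 * cmod w ^ 7 * (8 / 25)) * \<kappa> ^ k" for k
  proof -
    define u where "u = of_real (real k) * w"
    have suc: "of_nat (Suc k) * w = u + w" by (simp add: u_def algebra_simps)
    have "cmod (w * F 1 (u + of_real a * w)
       - (\<Sum>j\<le>5. of_real (bernpoly j a / fact j) * w ^ j * (F j (u + w) - F j u)))
       \<le> (9366 * \<kappa> ^ k) * cmod w ^ (5 + 2) * (1 / fact 5 + (\<Sum>j\<le>5. \<bar>bernpoly j a / fact j\<bar> / fact (Suc 5 - j)))"
    proof (rule euler_maclaurin_step)
      fix i x assume x: "x \<in> closed_segment u (u + w)"
      have sec: "\<bar>Im x\<bar> \<le> Re x" using sector_segment(1)[of x "real k"] x by (simp add: u_def)
      show "(F i has_field_derivative F (Suc i) x) (at x)"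
      proof (cases i)
        case 0
        thus ?thesis
          using DERIV_minus[OF has_field_derivative_log1p_exp[OF sec]]
          by (simp add: F_def[abs_def] fermi_deriv_0)
      next
        case (Suc j)
        thus ?thesis
          using has_field_derivative_fermi_deriv[OF exp_add_1_nonzero[OF sec]]
          by (simp add: F_def[abs_def])
      qed
    next
      fix x assume x: "x \<in> closed_segment u (u + w)"
      have sec: "\<bar>Im x\<bar> \<le> Re x" "real k * Re w \<le> Re x"
        using sector_segment[of x "real k"] x by (simp_all add: u_def)
      have "cmod (F (5 + 2) x) = cmod (fermi_deriv 6 x)"
        by (simp add: F_def eval_nat_numeral)
      also have "\<dots> \<le> 9366 * exp (- (Re x / 2))" by (rule norm_fermi_deriv_6_le[OF sec(1)])
      also have "\<dots> \<le> 9366 * exp (real k * - (Re w / 2))" using sec(2) by simp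
      also have "exp (real k * - (Re w / 2)) = \<kappa> ^ k" unfolding \<kappa>_def by (rule exp_of_nat_mult)
      finally show "cmod (F (5 + 2) x) \<le> 9366 * \<kappa> ^ k" .
    qed (use assms in auto)
    also have "\<dots> = (9366 * \<kappa> ^ k) * cmod w ^ 7 * c" by (simp add: c_def b_def)
    also have "\<dots> \<le> (9366 * \<kappa> ^ k) * cmod w ^ 7 * (8 / 25)"
      using c by (intro mult_left_mono) (auto simp: \<kappa>_def)
    also have "\<dots> = (9366 * cmod w ^ 7 * (8 / 25)) * \<kappa> ^ k" by simp
    finally show ?thesis unfolding suc unfolding u_def b_def of_real_of_nat_eq .
  qed
  have lim: "(\<lambda>k. F j (of_nat k * w)) \<longlonglongrightarrow> 0" for j
    using tendsto_minus[OF tendsto_log1p_exp_multiples[OF w(1)]] tendsto_fermi_deriv_multiples[OF w(1)]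
    by (cases j) (simp_all add: F_def)
  have \<kappa>: "0 \<le> \<kappa>" "\<kappa> < 1" using w by (auto simp: \<kappa>_def)
  have sums: "(\<lambda>k. F 1 (of_nat k * w + of_real a * w)) sums fermi_sum a w"
    using sums_fermi_sum[OF assms(2)] by (simp add: F_def fermi_deriv_0)
  have "cmod (w * fermi_sum a w + (\<Sum>j\<le>5. of_real (b j) * w ^ j * F j 0))
     \<le> (9366 * cmod w ^ 7 * (8 / 25)) / (1 - \<kappa>)"
    using euler_maclaurin_sum[of w F a 5, folded b_def, OF step lim \<kappa> sums] .
  also have "\<dots> = (9366 * cmod w ^ 7 * (8 / 25)) * (1 / (1 - \<kappa>))" by simp
  also have "\<dots> \<le> (9366 * cmod w ^ 7 * (8 / 25)) * (76 / (25 * cmod w))"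
    unfolding \<kappa>_def by (intro mult_left_mono geometric_denominator_bound assms) auto
  \<comment> \<open>The product 9366 * 8/25 * 76/25 is about 9111.\<close>
  also have "\<dots> \<le> cmod w * (9200 * cmod w ^ 5)"
    using w0 by (simp add: field_simps eval_nat_numeral)
  finally have fin: "cmod (w * fermi_sum a w + (\<Sum>j\<le>5. of_real (b j) * w ^ j * F j 0))
     \<le> cmod w * (9200 * cmod w ^ 5)" .
  have "w * fermi_sum a w + (\<Sum>j\<le>5. of_real (b j) * w ^ j * F j 0)
      = w * (fermi_sum a w - fermi_main a w)"
  proof -
    have F0: "F 0 0 = - of_real (ln 2)" "F 1 0 = 1 / 2" "F 2 0 = - 1 / 4" "F 3 0 = 0" "F 4 0 = 1 / 8"
      "F 5 0 = 0"
      using fermi_deriv_at_0 by (simp_all add: F_def log1p_exp_0 fermi_deriv_0 eval_nat_numeral)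
    have "b 0 = 1" using bernpoly_scaled_rec(1)[of a] by (simp add: b_def)
    hence "(\<Sum>j\<le>5. of_real (b j) * w ^ j * F j 0)
        = - of_real (ln 2) + of_real (b 1) * w / 2 - of_real (b 2) * w ^ 2 / 4 + of_real (b 4) * w ^ 4 / 8"
      by (simp add: sum_atMost_5 F0 del: One_nat_def)
    also have "\<dots> = - (w * fermi_main a w)"
      using w0 unfolding fermi_main_def b_def[symmetric]
      by (simp add: right_diff_distrib distrib_left power2_eq_square power3_eq_cube power4_eq_xxxx
          mult_ac del: One_nat_def)
    finally show ?thesis by (simp add: algebra_simps)
  qed
  with fin have "cmod w * cmod (fermi_sum a w - fermi_main a w) \<le> cmod w * (9200 * cmod w ^ 5)"
    by (simp add: norm_mult)
  thus ?thesis using w0 by simp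
qed

text \<open>Here a = 1, where the scaled Bernoulli values of index 3 and 5 vanish; for the indices 4
  and 6 it is the second and fourth derivative of the Fermi function at 0 that vanishes. So only j =
  0, 1, 2 survive. The chain starts one antiderivative earlier than for the Fermi sum, so K = 6
  again leads to the sixth derivative.\<close>

lemma log_xi_expansion:
  assumes "cmod w \<le> 1 / 8"
  shows "cmod (log_xi w - (of_real (pi\<^sup>2) / (12 * w) - of_real (ln 2 / 2) + w / 24)) \<le> 100 * cmod w ^ 6"
proof -
  have w0: "cmod w > 0" "w \<noteq> 0" using w by auto
  define b where "b j = bernpoly j 1 / fact j" for j
  define F where "F i u = (case i of 0 \<Rightarrow> - dilog_exp u
      | Suc j \<Rightarrow> (case j of 0 \<Rightarrow> log1p_exp u | Suc l \<Rightarrow> - fermi_deriv l u))" for i u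
  define \<kappa> where "\<kappa> = exp (- (Re w / 2))"
  define c where "c = (1 / fact 6 + (\<Sum>j\<le>6. \<bar>b j\<bar> / fact (Suc 6 - j)))"
  have b: "b 0 = 1" "b 1 = 1 / 2" "b 2 = 1 / 12" "b 3 = 0" "b 4 = - 1 / 720" "b 5 = 0" "b 6 = 1 / 30240"
    using bernpoly_scaled_at_1[folded b_def] bernpoly_scaled_rec(1)[of 1, folded b_def] by simp_all
  have c: "c \<le> 33 / 10000" by (simp add: c_def sum_atMost_6 b fact_numeral del: One_nat_def)
  have deriv_Suc: "(F (Suc i) has_field_derivative F (Suc (Suc i)) x) (at x)" if "\<bar>Im x\<bar> \<le> Re x" for i x
  proof (cases i)
    case 0
    thus ?thesis
      using has_field_derivative_log1p_exp[OF that] by (simp add: F_def[abs_def] fermi_deriv_0)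
  next
    case (Suc j)
    thus ?thesis
      using DERIV_minus[OF has_field_derivative_fermi_deriv[OF exp_add_1_nonzero[OF that]]]
      by (simp add: F_def[abs_def])
  qed
  have deriv: "(F i has_field_derivative F (Suc i) x) (at x)" if "\<bar>Im x\<bar> \<le> Re x" "Re x > 0" for i x
  proof (cases i)
    case 0
    thus ?thesis
      using DERIV_minus[OF has_field_derivative_dilog_exp[OF that(2)]] by (simp add: F_def[abs_def])
  qed (use deriv_Suc[OF that(1)] in auto)
  \<comment> \<open>The error of one step, with a real starting multiple s in place of a natural
    number so that s can tend to 0 from the right.\<close>
  define E where "E s = w * F 1 (of_real s * w + w)
      - (\<Sum>j\<le>6. of_real (b j) * w ^ j * (F j (of_real s * w + w) - F j (of_real s * w)))" for s :: real
  have E_pos: "cmod (E s) \<le> 9366 * exp (- (s * Re w / 2)) * cmod w ^ 8 * (33 / 10000)" if "s > 0" for s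
  proof -
    define u where "u = of_real s * w"
    have "cmod (w * F 1 (u + of_real 1 * w)
       - (\<Sum>j\<le>6. of_real (bernpoly j 1 / fact j) * w ^ j * (F j (u + w) - F j u)))
       \<le> (9366 * exp (- (s * Re w / 2))) * cmod w ^ (6 + 2) * (1 / fact 6 + (\<Sum>j\<le>6. \<bar>bernpoly j 1 / fact j\<bar> / fact (Suc 6 - j)))"
    proof (rule euler_maclaurin_step)
      fix i x assume x: "x \<in> closed_segment u (u + w)"
      have sec: "\<bar>Im x\<bar> \<le> Re x" "s * Re w \<le> Re x"
        using sector_segment[of x s] x that by (simp_all add: u_def)
      have "0 < s * Re w" using that w by simp
      thus "(F i has_field_derivative F (Suc i) x) (at x)" using sec by (intro deriv) auto
    next
      fix x assume x: "x \<in> closed_segment u (u + w)"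
      have sec: "\<bar>Im x\<bar> \<le> Re x" "s * Re w \<le> Re x"
        using sector_segment[of x s] x that by (simp_all add: u_def)
      have "cmod (F (6 + 2) x) = cmod (fermi_deriv 6 x)"
        by (simp add: F_def eval_nat_numeral)
      also have "\<dots> \<le> 9366 * exp (- (Re x / 2))" by (rule norm_fermi_deriv_6_le[OF sec(1)])
      also have "\<dots> \<le> 9366 * exp (- (s * Re w / 2))" using sec(2) by simp
      finally show "cmod (F (6 + 2) x) \<le> 9366 * exp (- (s * Re w / 2))" .
    qed auto
    also have "\<dots> = (9366 * exp (- (s * Re w / 2))) * cmod w ^ 8 * c" by (simp add: c_def b_def)
    also have "\<dots> \<le> (9366 * exp (- (s * Re w / 2))) * cmod w ^ 8 * (33 / 10000)"
      using c by (intro mult_left_mono) auto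
    finally show ?thesis by (simp add: E_def u_def b_def)
  qed
  (* The derivative of dilog_exp is only known in the open half plane, so the first step is
     reached as a limit. *)
  have E_0: "cmod (E 0) \<le> 9366 * exp (- (0 * Re w / 2)) * cmod w ^ 8 * (33 / 10000)"
  proof (rule tendsto_le)
    have lin: "((\<lambda>s. of_real s * w + v) \<longlongrightarrow> v) (at_right 0)" for v
      by (auto intro!: tendsto_eq_intros)
    have at_w: "((\<lambda>s. F j (of_real s * w + w)) \<longlongrightarrow> F j w) (at_right 0)" for j
      by (rule isCont_tendsto_compose[OF DERIV_isCont[OF deriv] lin]) (use w in auto)
    have at_0: "((\<lambda>s. F j (of_real s * w)) \<longlongrightarrow> F j 0) (at_right 0)" for j
    proof (cases j)
      case 0
      have "((\<lambda>s. dilog_exp (of_real s * w)) \<longlongrightarrow> dilog_exp 0) (at_right 0)"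
      proof (rule continuous_on_tendsto_compose[OF continuous_on_dilog_exp])
        show "((\<lambda>s. of_real s * w) \<longlongrightarrow> 0) (at_right 0)" using lin[of 0] by simp
        show "\<forall>\<^sub>F s in at_right 0. of_real s * w \<in> {u. 0 \<le> Re u}"
          using w by (intro eventually_at_right_less[THEN eventually_mono]) auto
      qed auto
      thus ?thesis using 0 by (auto simp: F_def intro!: tendsto_minus)
    next
      case (Suc i)
      show ?thesis
        using isCont_tendsto_compose[OF DERIV_isCont[OF deriv_Suc[of 0 i]] lin[of 0]] Suc by simp
    qed
    have "((\<lambda>s. cmod (E s)) \<longlongrightarrow> cmod (w * F 1 w
        - (\<Sum>j\<le>6. of_real (b j) * w ^ j * (F j w - F j 0)))) (at_right 0)"
      unfolding E_def by (intro tendsto_intros at_w at_0)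
    thus "((\<lambda>s. cmod (E s)) \<longlongrightarrow> cmod (E 0)) (at_right 0)"
      by (simp add: E_def)
    show "((\<lambda>s. 9366 * exp (- (s * Re w / 2)) * cmod w ^ 8 * (33 / 10000))
        \<longlongrightarrow> 9366 * exp (- (0 * Re w / 2)) * cmod w ^ 8 * (33 / 10000)) (at_right 0)"
      by (intro tendsto_intros) auto
    show "\<forall>\<^sub>F s in at_right 0. cmod (E s) \<le> 9366 * exp (- (s * Re w / 2)) * cmod w ^ 8 * (33 / 10000)"
      by (rule eventually_mono[OF eventually_at_right_less E_pos])
  qed auto
  have step: "cmod (w * F 1 (of_nat k * w + of_real 1 * w)
       - (\<Sum>j\<le>6. of_real (b j) * w ^ j * (F j (of_nat (Suc k) * w) - F j (of_nat k * w))))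
       \<le> (9366 * cmod w ^ 8 * (33 / 10000)) * \<kappa> ^ k" for k
  proof -
    have suc: "of_nat (Suc k) * w = of_real (real k) * w + w" by (simp add: algebra_simps)
    have "cmod (E (real k)) \<le> 9366 * exp (- (real k * Re w / 2)) * cmod w ^ 8 * (33 / 10000)"
      using E_pos[of "real k"] E_0 by (cases "k = 0") auto
    also have "exp (- (real k * Re w / 2)) = \<kappa> ^ k"
      unfolding \<kappa>_def by (simp flip: exp_of_nat_mult)
    finally show ?thesis unfolding suc E_def by (simp add: mult_ac del: One_nat_def)
  qed
  have lim: "(\<lambda>k. F j (of_nat k * w)) \<longlonglongrightarrow> 0" for j
  proof (cases j)
    case 0
    thus ?thesis
      using tendsto_minus[OF tendsto_dilog_exp_multiples[OF w(1)]] by (simp add: F_def)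
  next
    case (Suc i)
    thus ?thesis
      using tendsto_minus[OF tendsto_fermi_deriv_multiples[OF w(1)]] tendsto_log1p_exp_multiples[OF w(1)]
      by (cases i) (simp_all add: F_def)
  qed
  have \<kappa>: "0 \<le> \<kappa>" "\<kappa> < 1" using w by (auto simp: \<kappa>_def)
  have sums: "(\<lambda>k. F 1 (of_nat k * w + of_real 1 * w)) sums log_xi w"
    using sums_log_xi[OF w(1)] by (simp add: F_def)
  have "cmod (w * log_xi w + (\<Sum>j\<le>6. of_real (b j) * w ^ j * F j 0))
     \<le> (9366 * cmod w ^ 8 * (33 / 10000)) / (1 - \<kappa>)"
    using euler_maclaurin_sum[of w F 1 6, folded b_def, OF step lim \<kappa> sums] .
  also have "\<dots> = (9366 * cmod w ^ 8 * (33 / 10000)) * (1 / (1 - \<kappa>))" by simp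
  also have "\<dots> \<le> (9366 * cmod w ^ 8 * (33 / 10000)) * (76 / (25 * cmod w))"
    unfolding \<kappa>_def by (intro mult_left_mono geometric_denominator_bound assms) auto
  \<comment> \<open>The product 9366 * 33/10000 * 76/25 is about 94.\<close>
  also have "\<dots> \<le> cmod w * (100 * cmod w ^ 6)"
    using w0 by (simp add: field_simps eval_nat_numeral)
  finally have fin: "cmod (w * log_xi w + (\<Sum>j\<le>6. of_real (b j) * w ^ j * F j 0))
     \<le> cmod w * (100 * cmod w ^ 6)" .
  have "w * log_xi w + (\<Sum>j\<le>6. of_real (b j) * w ^ j * F j 0)
      = w * (log_xi w - (of_real (pi\<^sup>2) / (12 * w) - of_real (ln 2 / 2) + w / 24))"
  proof -
    have F0: "F 0 0 = - of_real (pi\<^sup>2 / 12)" "F 1 0 = of_real (ln 2)" "F 2 0 = - 1 / 2" "F 4 0 = 0" "F 6 0 = 0"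
      using fermi_deriv_at_0
      by (simp_all add: F_def dilog_exp_0 log1p_exp_0 fermi_deriv_0 eval_nat_numeral)
    have "(\<Sum>j\<le>6. of_real (b j) * w ^ j * F j 0)
        = - of_real (pi\<^sup>2 / 12) + w * of_real (ln 2) / 2 - w ^ 2 / 24"
      by (simp add: sum_atMost_6 F0 b power2_eq_square del: One_nat_def)
    thus ?thesis
      using w0 by (simp only:) (simp add: field_simps power2_eq_square)
  qed
  with fin have "cmod w * cmod (log_xi w - (of_real (pi\<^sup>2) / (12 * w) - of_real (ln 2 / 2) + w / 24))
      \<le> cmod w * (100 * cmod w ^ 6)"
    by (simp add: norm_mult)
  thus ?thesis using w0 by simp
qed

end

subsection \<open>Bounds away from the saddle point\<close>

definition fermi_arith_sum :: "nat \<Rightarrow> nat \<Rightarrow> complex \<Rightarrow> complex" where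
  "fermi_arith_sum r t z = (\<Sum>k. fermi (of_nat (k * t + r) * z))"

text \<open>Rescaling by t turns the residue class into a shift by r/t, the form that the Fermi
  expansion treats; hence the error there is a power of t z.\<close>

lemma fermi_arith_sum_eq:
  assumes "t > 0"
  shows "fermi_arith_sum r t z = fermi_sum (real r / real t) (of_nat t * z)"
  unfolding fermi_arith_sum_def fermi_sum_def using assms
  by (intro arg_cong[where f = suminf] ext arg_cong[where f = fermi]) (simp add: field_simps)

text \<open>Outside the sector u may approach a pole at an odd multiple of i pi, which explains the
  factor 1/x. The bound comes from exp y - 1 >= exp(y/2) (exp(y/2) - 1) >= exp(y/2) y/2 for y = Re
  u.\<close>

lemma norm_fermi_le_right_half_plane:
  assumes "0 < x" "x \<le> Re u"
  shows "cmod (fermi u) \<le> 2 * exp (- (x / 2)) / x"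
proof -
  define y where "y = Re u"
  have y: "0 < y" "x \<le> y" using assms by (auto simp: y_def)
  have "exp (y / 2) * (y / 2) \<le> exp (y / 2) * (exp (y / 2) - 1)"
  proof (rule mult_left_mono)
    show "y / 2 \<le> exp (y / 2) - 1" using exp_ge_add_one_self[of "y / 2"] by linarith
  qed simp
  also have "\<dots> = exp y - exp (y / 2)" by (simp add: right_diff_distrib flip: exp_add)
  also have "\<dots> \<le> exp y - 1" using y by simp
  also have "\<dots> \<le> cmod (exp u + 1)"
    using norm_diff_ineq[of "exp u" 1] by (simp add: y_def)
  finally have "exp (y / 2) * (y / 2) \<le> cmod (exp u + 1)" .
  moreover have pos: "0 < exp (y / 2) * (y / 2)" using y by simp
  ultimately have "cmod (fermi u) \<le> 1 / (exp (y / 2) * (y / 2))"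
    unfolding fermi_def norm_divide norm_one
    by (intro divide_left_mono mult_pos_pos less_le_trans[OF pos]) auto
  also have "\<dots> \<le> 1 / (exp (x / 2) * (x / 2))"
    using y assms by (intro divide_left_mono mult_mono mult_pos_pos) auto
  finally show ?thesis by (simp add: exp_minus field_simps)
qed

lemma norm_fermi_multiple_le:
  assumes "0 < Re z" "k < m"
  shows "cmod (fermi (of_nat m * z)) \<le> 2 * exp (- (Re z / 2)) ^ Suc k / Re z"
proof -
  have km: "real (Suc k) * Re z \<le> real m * Re z"
    using assms by (intro mult_right_mono) auto
  have "cmod (fermi (of_nat m * z)) \<le> 2 * exp (- (real (Suc k) * Re z / 2)) / (real (Suc k) * Re z)"
    by (rule norm_fermi_le_right_half_plane) (use assms km in auto)
  also have "\<dots> \<le> 2 * exp (- (real (Suc k) * Re z / 2)) / Re z"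
    using assms by (intro divide_left_mono mult_pos_pos) (auto simp: algebra_simps)
  also have "exp (- (real (Suc k) * Re z / 2)) = exp (- (Re z / 2)) ^ Suc k"
  proof -
    have "- (real (Suc k) * Re z / 2) = real (Suc k) * - (Re z / 2)" by simp
    thus ?thesis by (simp only: exp_of_nat_mult)
  qed
  finally show ?thesis .
qed

lemma sums_fermi_majorant:
  fixes x :: real
  assumes "0 < x"
  obtains s where "(\<lambda>k. 2 * exp (- (x / 2)) ^ Suc k / x) sums s" "s \<le> 4 / x\<^sup>2"
proof -
  define \<kappa> where "\<kappa> = exp (- (x / 2))"
  have \<kappa>: "0 < \<kappa>" "\<kappa> < 1" using assms by (auto simp: \<kappa>_def)
  have "(\<lambda>k. 2 * \<kappa> / x * \<kappa> ^ k) sums (2 * \<kappa> / x * (1 / (1 - \<kappa>)))"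
    using \<kappa> by (intro sums_mult geometric_sums) auto
  moreover have "2 * \<kappa> / x * \<kappa> ^ k = 2 * \<kappa> ^ Suc k / x" for k by simp
  ultimately have "(\<lambda>k. 2 * \<kappa> ^ Suc k / x) sums (2 * \<kappa> / x * (1 / (1 - \<kappa>)))" by (simp only:)
  moreover have "\<kappa> * (1 + x / 2) \<le> \<kappa> * exp (x / 2)"
    using \<kappa> by (intro mult_left_mono exp_ge_add_one_self) auto
  hence "\<kappa> * (1 + x / 2) \<le> 1" by (simp add: \<kappa>_def flip: exp_add)
  hence "2 * \<kappa> * x \<le> 4 * (1 - \<kappa>)" by (simp add: algebra_simps)
  hence "2 * \<kappa> / x * (1 / (1 - \<kappa>)) \<le> 4 / x\<^sup>2"
    using \<kappa> assms by (simp add: divide_simps power2_eq_square mult_ac)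
  ultimately show ?thesis using that unfolding \<kappa>_def by blast
qed

lemma sums_fermi_arith_sum:
  assumes "0 < Re z" "0 < r" "0 < t"
  shows "(\<lambda>k. fermi (of_nat (k * t + r) * z)) sums fermi_arith_sum r t z"
    and "cmod (fermi_arith_sum r t z) \<le> 4 / (Re z)\<^sup>2"
proof -
  obtain s where s: "(\<lambda>k. 2 * exp (- (Re z / 2)) ^ Suc k / Re z) sums s" "s \<le> 4 / (Re z)\<^sup>2"
    using sums_fermi_majorant[OF assms(1)] .
  have le: "cmod (fermi (of_nat (k * t + r) * z)) \<le> 2 * exp (- (Re z / 2)) ^ Suc k / Re z" for k
  proof (rule norm_fermi_multiple_le)
    have "k * 1 \<le> k * t" using assms by (intro mult_left_mono) auto
    thus "k < k * t + r" using assms by linarith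
  qed fact
  have "summable (\<lambda>k. fermi (of_nat (k * t + r) * z))"
    by (rule summable_comparison_test'[OF sums_summable[OF s(1)] le])
  thus "(\<lambda>k. fermi (of_nat (k * t + r) * z)) sums fermi_arith_sum r t z"
    unfolding fermi_arith_sum_def by (rule summable_sums)
  have "cmod (fermi_arith_sum r t z) \<le> s"
    unfolding fermi_arith_sum_def sums_unique[OF s(1)]
    by (rule norm_suminf_le[OF le sums_summable[OF s(1)]])
  thus "cmod (fermi_arith_sum r t z) \<le> 4 / (Re z)\<^sup>2" using s(2) by simp
qed

lemma one_plus_exp_nonzero:
  assumes "Re u > 0"
  shows "1 + exp (- u) \<noteq> 0"
proof
  assume "1 + exp (- u) = 0"
  hence "exp (- u) = -1" by (simp add: eq_neg_iff_add_eq_0 add.commute)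
  hence "cmod (exp (- u)) = 1" by (simp only: norm_minus_cancel norm_one)
  thus False using assms by simp
qed

text \<open>With d = \<open>\<rho> - Re q\<close> one has |1 + q|^2 =
  \<open>(1 + \<rho>)^2 - 2 * d\<close>. As \<open>(1 + \<rho>)^2 \<le> 4\<close>, this is at most
  \<open>(1 + \<rho>)^2 * (1 - d / 2)\<close>, and 1 - d/2 <= exp(-d/2) makes the saving additive in
  the logarithm; the square root halves d/2 to d/4.\<close>

lemma Re_log1p_exp_le:
  assumes "0 < Re u"
  shows "Re (log1p_exp u)
       \<le> ln (1 + exp (- Re u)) - (exp (- Re u) - Re (exp (- u))) / 4"
proof -
  define q \<rho> where "q = exp (- u)" and "\<rho> = exp (- Re u)"
  have \<rho>: "cmod q = \<rho>" "0 < \<rho>" "\<rho> < 1" using assms by (auto simp: q_def \<rho>_def)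
  have Re_q: "\<bar>Re q\<bar> \<le> \<rho>" using abs_Re_le_cmod[of q] \<rho> by simp
  have nz: "1 + q \<noteq> 0" unfolding q_def by (rule one_plus_exp_nonzero[OF assms])
  define d where "d = \<rho> - Re q"
  have "(cmod (1 + q))\<^sup>2 = 1 + 2 * Re q + ((Re q)\<^sup>2 + (Im q)\<^sup>2)"
    unfolding cmod_power2 by (simp add: power2_eq_square algebra_simps)
  also have "(Re q)\<^sup>2 + (Im q)\<^sup>2 = \<rho>\<^sup>2" using \<rho>(1) by (simp flip: cmod_power2)
  finally have eq: "(cmod (1 + q))\<^sup>2 = (1 + \<rho>)\<^sup>2 - 2 * d"
    by (simp add: d_def power2_eq_square algebra_simps)
  have "(1 + \<rho>)\<^sup>2 \<le> 2\<^sup>2" using \<rho> by (intro power_mono) auto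
  hence "(1 + \<rho>)\<^sup>2 * (d / 2) \<le> 2\<^sup>2 * (d / 2)"
    using Re_q by (intro mult_right_mono) (auto simp: d_def)
  hence "(cmod (1 + q))\<^sup>2 \<le> (1 + \<rho>)\<^sup>2 * (1 + - (d / 2))"
    unfolding eq distrib_left by simp
  also have "\<dots> \<le> (1 + \<rho>)\<^sup>2 * exp (- (d / 2))"
    by (intro mult_left_mono exp_ge_add_one_self) auto
  also have "\<dots> = ((1 + \<rho>) * exp (- (d / 4)))\<^sup>2"
    by (simp add: power_mult_distrib flip: exp_double)
  finally have "cmod (1 + q) \<le> (1 + \<rho>) * exp (- (d / 4))"
    by (rule power2_le_imp_le) (use \<rho> in auto)
  hence "ln (cmod (1 + q)) \<le> ln ((1 + \<rho>) * exp (- (d / 4)))"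
    using nz \<rho> by (subst ln_le_cancel_iff) auto
  also have "\<dots> = ln (1 + \<rho>) - d / 4" using \<rho> by (simp add: ln_mult)
  finally show ?thesis
    using nz by (simp add: log1p_exp_def q_def \<rho>_def d_def)
qed

lemma log1p_exp_of_real: "log1p_exp (of_real x) = of_real (ln (1 + exp (- x)))"
proof -
  have "1 + exp (- complex_of_real x) = of_real (1 + exp (- x))"
    by (simp add: exp_of_real[symmetric])
  thus ?thesis
    unfolding log1p_exp_def by (simp only: Ln_of_real[OF add_pos_pos[OF zero_less_one exp_gt_zero]])
qed

text \<open>The savings of the single factors, taken at all powers of q, add up to the difference of
  two geometric series.\<close>

lemma Re_log_xi_le:
  assumes "0 < Re z"
  defines "q \<equiv> exp (- z)" and "\<rho> \<equiv> exp (- Re z)"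
  shows "Re (log_xi z) \<le> Re (log_xi (of_real (Re z))) - (\<rho> / (1 - \<rho>) - Re (q / (1 - q))) / 4"
proof -
  have norm: "cmod q < 1" "cmod q = \<rho>" "0 < \<rho>" "\<rho> < 1" using assms by (auto simp: q_def \<rho>_def)
  have L: "(\<lambda>k. Re (log1p_exp (of_nat k * z + z))) sums Re (log_xi z)"
    by (intro sums_Re sums_log_xi assms)
  have R: "(\<lambda>k. Re (log1p_exp (of_nat k * of_real (Re z) + of_real (Re z)))) sums Re (log_xi (of_real (Re z)))"
    using assms by (intro sums_Re sums_log_xi) simp
  have "(\<lambda>k. q * q ^ k) sums (q * (1 / (1 - q)))"
    using norm by (intro sums_mult geometric_sums)
  hence Q: "(\<lambda>k. Re (q ^ Suc k)) sums Re (q / (1 - q))"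
    using sums_Re by fastforce
  have "(\<lambda>k. \<rho> * \<rho> ^ k) sums (\<rho> * (1 / (1 - \<rho>)))"
    using norm by (intro sums_mult geometric_sums) simp
  hence P: "(\<lambda>k. \<rho> ^ Suc k) sums (\<rho> / (1 - \<rho>))" by simp
  have "Re (log1p_exp (of_nat k * z + z)) \<le> Re (log1p_exp (of_nat k * of_real (Re z) + of_real (Re z)))
      - (\<rho> ^ Suc k - Re (q ^ Suc k)) / 4" for k
  proof -
    define u where "u = of_nat k * z + z"
    have Re_u: "Re u = real (Suc k) * Re z" by (simp add: u_def algebra_simps)
    have "0 < Re u" using assms unfolding Re_u by simp
    note Re_log1p_exp_le[OF this]
    moreover have "of_nat k * complex_of_real (Re z) + of_real (Re z) = of_real (Re u)"
      by (simp add: u_def)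
    hence "Re (log1p_exp (of_nat k * of_real (Re z) + of_real (Re z))) = ln (1 + exp (- Re u))"
      by (simp only: log1p_exp_of_real Re_complex_of_real)
    moreover have "exp (- Re u) = \<rho> ^ Suc k"
      unfolding Re_u \<rho>_def by (simp only: mult_minus_right[symmetric] exp_of_nat_mult)
    moreover have "- u = of_nat (Suc k) * (- z)" by (simp add: u_def algebra_simps)
    hence "exp (- u) = q ^ Suc k"
      unfolding q_def by (simp only: exp_of_nat_mult)
    ultimately show ?thesis by (simp add: u_def)
  qed
  thus ?thesis
    by (rule sums_le[OF _ L sums_diff[OF R sums_divide[OF sums_diff[OF P Q]]]])
qed

text \<open>The quadratic term contributes x^2/2, and the quartic remainder x^4/24 is covered by
  x^2/10; monotonicity of the cosine on [0, pi] passes from x to y.\<close>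

lemma one_minus_cos_ge:
  fixes x y :: real
  assumes "0 < x" "x \<le> 1 / 20" "x \<le> \<bar>y\<bar>" "\<bar>y\<bar> \<le> pi"
  shows "2 / 5 * x\<^sup>2 \<le> 1 - cos y"
proof -
  obtain t where t: "cos x = (\<Sum>m<4. cos_coeff m * x ^ m) + (cos (t + 1/2 * real 4 * pi) / fact 4) * x ^ 4"
    using Maclaurin_cos_expansion2[of x 4] assms by auto
  have four: "{..<4 :: nat} = {0, 1, 2, 3}" by auto
  have "cos (t + 1/2 * real 4 * pi) / fact 4 * x ^ 4 \<le> 1 / fact 4 * x ^ 4"
    by (intro mult_right_mono divide_right_mono) auto
  also have "x ^ 4 = x\<^sup>2 * x\<^sup>2" by (simp flip: power_add)
  also have "1 / fact 4 * (x\<^sup>2 * x\<^sup>2) \<le> 1 / fact 4 * (x\<^sup>2 * 1\<^sup>2)"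
    using assms by (intro mult_left_mono power_mono) auto
  also have "\<dots> \<le> x\<^sup>2 / 10" by (simp add: fact_numeral)
  finally have "cos x \<le> 1 - x\<^sup>2 / 2 + x\<^sup>2 / 10"
    unfolding t by (simp add: four cos_coeff_def fact_numeral)
  moreover have "cos \<bar>y\<bar> \<le> cos x" using assms by (intro cos_monotone_0_pi_le) auto
  ultimately show ?thesis by simp
qed

text \<open>With c = 1 - cos y and N = |1 - q|^2 the gap equals
  \<open>\<rho> * (1 + \<rho>) * c / ((1 - \<rho>) * N)\<close>. Since
  \<open>(1 - \<rho>)^2 \<le> x^2 \<le> 5 / 2 * c\<close>, N is at most a multiple of c, so c
  cancels and a bound in x alone remains.\<close>

lemma geometric_gap:
  assumes "0 < x" "x \<le> 1 / 20" "x \<le> \<bar>y\<bar>" "\<bar>y\<bar> \<le> pi"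
  defines "q \<equiv> exp (- Complex x y)" and "\<rho> \<equiv> exp (- x)"
  shows "2 / (5 * x) \<le> \<rho> / (1 - \<rho>) - Re (q / (1 - q))"
proof -
  define c where "c = 1 - cos y"
  have c: "2 / 5 * x\<^sup>2 \<le> c" unfolding c_def by (rule one_minus_cos_ge[OF assms(1-4)])
  have x2: "0 < x\<^sup>2" using assms by simp
  have c0: "0 < c" using c x2 by linarith
  have \<rho>: "0 < \<rho>" "\<rho> < 1" "1 - \<rho> \<le> x" using assms(1) exp_ge_add_one_self[of "-x"] by (auto simp: \<rho>_def)
  hence \<rho>2: "19 / 20 \<le> \<rho>" using assms by simp
  have q: "Re q = \<rho> * cos y" "Im q = - (\<rho> * sin y)" by (simp_all add: q_def \<rho>_def Re_exp Im_exp)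
  have sc: "(cos y)\<^sup>2 + (sin y)\<^sup>2 = 1" by simp
  define N where "N = (1 - \<rho>)\<^sup>2 + 2 * \<rho> * c"
  have N0: "0 < N" unfolding N_def using \<rho> c0 by (intro add_nonneg_pos) auto
  have N: "(Re (1 - q))\<^sup>2 + (Im (1 - q))\<^sup>2 = N"
  proof -
    have "(Re (1 - q))\<^sup>2 + (Im (1 - q))\<^sup>2 = 1 - 2 * \<rho> * cos y + \<rho>\<^sup>2 * ((cos y)\<^sup>2 + (sin y)\<^sup>2)"
      by (simp only: minus_complex.sel one_complex.sel q) algebra
    thus ?thesis unfolding sc N_def c_def by (simp add: power2_eq_square algebra_simps)
  qed
  have "Re (q / (1 - q)) = (Re q * Re (1 - q) + Im q * Im (1 - q)) / N"
    by (simp add: Re_divide flip: N)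
  also have "Re q * Re (1 - q) + Im q * Im (1 - q) = \<rho> * cos y - \<rho>\<^sup>2 * ((cos y)\<^sup>2 + (sin y)\<^sup>2)"
    by (simp only: minus_complex.sel one_complex.sel q) algebra
  finally have Re_eq: "Re (q / (1 - q)) = (\<rho> * (1 - c) - \<rho>\<^sup>2) / N" by (simp add: sc c_def)
  have eq: "\<rho> / (1 - \<rho>) - Re (q / (1 - q)) = \<rho> * (1 + \<rho>) * c / ((1 - \<rho>) * N)"
  proof -
    have "\<rho> * N - (\<rho> * (1 - c) - \<rho>\<^sup>2) * (1 - \<rho>) = \<rho> * (1 + \<rho>) * c"
      unfolding N_def by (simp add: power2_eq_square algebra_simps)
    moreover have "1 - \<rho> \<noteq> 0" using \<rho> by simp
    ultimately show ?thesis
      unfolding Re_eq using N0 by (simp add: diff_frac_eq)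
  qed
  have "2 * ((1 - \<rho>) * N) \<le> 2 * (x * N)" using \<rho> N0 by simp
  also have "\<dots> \<le> 2 * (x * (5 / 2 * c + 2 * \<rho> * c))"
  proof -
    have "(1 - \<rho>)\<^sup>2 \<le> x\<^sup>2" using \<rho> by (intro power_mono) auto
    thus ?thesis unfolding N_def using c assms(1) by (intro mult_left_mono) auto
  qed
  also have "\<dots> = x * c * (5 + 4 * \<rho>)" by (simp add: algebra_simps)
  \<comment> \<open>This amounts to \<open>5 \<le> \<rho> + 5 * \<rho>^2\<close>, which
    \<open>19 / 20 \<le> \<rho>\<close> guarantees.\<close>
  also have "\<dots> \<le> x * c * (5 * (\<rho> * (1 + \<rho>)))"
  proof (intro mult_left_mono)
    have "19 / 20 * \<rho> \<le> \<rho> * \<rho>" using \<rho>2 \<rho> by (intro mult_right_mono) auto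
    moreover have "5 * (\<rho> * (1 + \<rho>)) = 5 * \<rho> + 5 * (\<rho> * \<rho>)" by (simp add: algebra_simps)
    ultimately show "5 + 4 * \<rho> \<le> 5 * (\<rho> * (1 + \<rho>))" using \<rho>2 by linarith
  qed (use assms c0 in auto)
  finally have "2 * ((1 - \<rho>) * N) \<le> \<rho> * (1 + \<rho>) * c * (5 * x)" by (simp add: mult_ac)
  thus ?thesis
    unfolding eq using \<rho> N0 assms(1) by (simp add: divide_simps mult_ac)
qed

text \<open>The constant -ln 2 / 2 <= -1/3 absorbs both x/24 and the remainder 100 x^6.\<close>

lemma Re_log_xi_real_le:
  assumes "0 < x" "x \<le> 1 / 20"
  shows "Re (log_xi (of_real x)) \<le> pi\<^sup>2 / (12 * x)"
proof -
  have "cmod (log_xi (of_real x) - (of_real (pi\<^sup>2) / (12 * of_real x) - of_real (ln 2 / 2) + of_real x / 24))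
      \<le> 100 * cmod (of_real x) ^ 6"
    using assms by (intro log_xi_expansion) auto
  hence "Re (log_xi (of_real x) - (of_real (pi\<^sup>2) / (12 * of_real x) - of_real (ln 2 / 2) + of_real x / 24))
      \<le> 100 * x ^ 6"
    using complex_Re_le_cmod order_trans assms by fastforce
  moreover have "of_real (pi\<^sup>2) / (12 * of_real x) - of_real (ln 2 / 2) + of_real x / 24
      = complex_of_real (pi\<^sup>2 / (12 * x) - ln 2 / 2 + x / 24)" by simp
  ultimately have "Re (log_xi (of_real x)) \<le> pi\<^sup>2 / (12 * x) - ln 2 / 2 + x / 24 + 100 * x ^ 6"
    by (simp add: algebra_simps)
  moreover have "x ^ 6 \<le> (1 / 20) ^ 6" using assms by (intro power_mono) auto
  moreover have "(1 / 20 :: real) ^ 6 \<le> 1 / 1000" by (simp add: power_divide)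
  ultimately show ?thesis using assms ln2_ge_two_thirds by linarith
qed

lemma pi_squared_bounds: "9 \<le> pi\<^sup>2" "pi\<^sup>2 \<le> 10"
proof -
  have "3\<^sup>2 \<le> pi\<^sup>2" using pi_gt3 by (intro power_mono) auto
  thus "9 \<le> pi\<^sup>2" by simp
  have "pi\<^sup>2 \<le> 3.15\<^sup>2" using pi_approx(2) by (intro power_mono) auto
  thus "pi\<^sup>2 \<le> 10" by (simp add: power2_eq_square)
qed

text \<open>The gap above, divided by 4, is 1/(10 x), and pi^2/12 - 1/10 < 3/4. At x = eta the bound
  becomes the part 3 sqrt 3/(2 pi) sqrt n of the last exponent in \<open>Err\<close>.\<close>

lemma Re_log_xi_minor_arc:
  assumes "0 < x" "x \<le> 1 / 20" "x \<le> \<bar>y\<bar>" "\<bar>y\<bar> \<le> pi"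
  shows "Re (log_xi (Complex x y)) \<le> 3 / (4 * x)"
proof -
  have "Re (log_xi (Complex x y)) \<le> Re (log_xi (of_real x))
      - (exp (- x) / (1 - exp (- x)) - Re (exp (- Complex x y) / (1 - exp (- Complex x y)))) / 4"
    using Re_log_xi_le[of "Complex x y"] assms(1) by simp
  also have "\<dots> \<le> pi\<^sup>2 / (12 * x) - 2 / (5 * x) / 4"
    using geometric_gap[OF assms] Re_log_xi_real_le[OF assms(1,2)]
    by (intro diff_mono divide_right_mono) auto
  also have "\<dots> = (pi\<^sup>2 / 12 - 1 / 10) * (1 / x)" using assms(1) by (simp add: field_simps)
  also have "\<dots> \<le> (3 / 4) * (1 / x)"
  proof (intro mult_right_mono)
    show "pi\<^sup>2 / 12 - 1 / 10 \<le> 3 / 4" using pi_squared_bounds(2) by simp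
  qed (use assms in auto)
  finally show ?thesis by simp
qed

subsection \<open>The coefficient integral\<close>

text \<open>Both sides are the weighted count of sets P with one marked element m satisfying R:
  fixing m gives the factor x m, and every other index is free to belong to P or not.\<close>

lemma sum_Pow_card_prod:
  fixes x :: "'a \<Rightarrow> 'b :: field"
  assumes "finite S" "\<And>l. l \<in> S \<Longrightarrow> 1 + x l \<noteq> 0"
  shows "(\<Sum>P\<in>Pow S. of_nat (card {k\<in>P. R k}) * (\<Prod>l\<in>P. x l))
       = (\<Prod>l\<in>S. 1 + x l) * (\<Sum>m\<in>S. if R m then x m / (1 + x m) else 0)"
  using assms
proof (induction S rule: finite_induct)
  case empty
  thus ?case by simp
next
  case (insert s S)
  have fin: "finite P" if "P \<in> Pow S" for P using that insert.hyps finite_subset by auto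
  have notin: "s \<notin> P" if "P \<in> Pow S" for P using that insert.hyps by auto
  have inj: "inj_on (insert s) (Pow S)"
    using notin by (auto simp: inj_on_def) (metis insert_ident notin PowI)+
  have disj: "Pow S \<inter> insert s ` Pow S = {}" using insert.hyps by auto
  have card: "card {k \<in> insert s P. R k} = (if R s then 1 else 0) + card {k\<in>P. R k}"
    if "P \<in> Pow S" for P
  proof -
    have "{k \<in> insert s P. R k} = (if R s then insert s {k\<in>P. R k} else {k\<in>P. R k})" by auto
    thus ?thesis using fin[OF that] notin[OF that] by simp
  qed
  have prod: "(\<Prod>l\<in>insert s P. x l) = x s * (\<Prod>l\<in>P. x l)" if "P \<in> Pow S" for P
    using fin[OF that] notin[OF that] by simp
  have Q: "(\<Sum>P\<in>Pow S. \<Prod>l\<in>P. x l) = (\<Prod>l\<in>S. 1 + x l)"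
    using prod_add[OF insert.hyps(1), of x "\<lambda>_. 1"] by (simp add: add.commute)
  define B where "B = (\<Sum>P\<in>Pow S. of_nat (card {k\<in>P. R k}) * (\<Prod>l\<in>P. x l))"
  have "(\<Sum>P\<in>Pow (insert s S). of_nat (card {k\<in>P. R k}) * (\<Prod>l\<in>P. x l))
      = B + (\<Sum>P\<in>Pow S. of_nat (card {k \<in> insert s P. R k}) * (\<Prod>l\<in>insert s P. x l))"
    unfolding Pow_insert B_def using insert.hyps disj inj
    by (subst sum.union_disjoint) (auto simp: sum.reindex)
  also have "(\<Sum>P\<in>Pow S. of_nat (card {k \<in> insert s P. R k}) * (\<Prod>l\<in>insert s P. x l))
      = (\<Sum>P\<in>Pow S. (if R s then x s else 0) * (\<Prod>l\<in>P. x l)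
          + x s * (of_nat (card {k\<in>P. R k}) * (\<Prod>l\<in>P. x l)))"
    by (rule sum.cong[OF refl], simp only: card prod) (simp add: algebra_simps)
  also have "\<dots> = (if R s then x s else 0) * (\<Prod>l\<in>S. 1 + x l) + x s * B"
    unfolding sum.distrib B_def Q[symmetric] by (simp add: sum_distrib_left)
  finally have "(\<Sum>P\<in>Pow (insert s S). of_nat (card {k\<in>P. R k}) * (\<Prod>l\<in>P. x l))
      = (1 + x s) * B + (if R s then x s else 0) * (\<Prod>l\<in>S. 1 + x l)"
    by (simp add: algebra_simps)
  moreover have "B = (\<Prod>l\<in>S. 1 + x l) * (\<Sum>m\<in>S. if R m then x m / (1 + x m) else 0)"
    unfolding B_def using insert by simp
  moreover have "(1 + x s) * (if R s then x s / (1 + x s) else 0) = (if R s then x s else 0)"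
    using insert by simp
  ultimately show ?case
    by (simp only: prod.insert[OF insert.hyps] sum.insert[OF insert.hyps]) algebra
qed

lemma has_integral_exp_circle:
  fixes k :: int
  shows "((\<lambda>y. exp (of_int k * Complex x y)) has_integral (if k = 0 then 2 * of_real pi else 0)) {-pi..pi}"
proof (cases "k = 0")
  case True
  thus ?thesis using has_integral_const_real[of "1 :: complex" "-pi" pi] by (simp add: scaleR_conv_of_real)
next
  case False
  define G where "G y = exp (of_int k * Complex x y) / (of_int k * \<i>)" for y
  have lin: "((\<lambda>y. of_int k * Complex x y) has_vector_derivative of_int k * \<i>) (at y within A)" for y A
    unfolding Complex_eq by (auto intro!: derivative_eq_intros)
  have "((\<lambda>y. exp (of_int k * Complex x y)) has_integral (G pi - G (-pi))) {-pi..pi}"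
  proof (rule fundamental_theorem_of_calculus)
    fix y
    have "((\<lambda>y. exp (of_int k * Complex x y)) has_vector_derivative
        (of_int k * \<i>) * exp (of_int k * Complex x y)) (at y within {-pi..pi})"
      using field_vector_diff_chain_within[OF lin has_field_derivative_at_within[OF DERIV_exp]]
      by (simp only: o_def)
    hence "(G has_vector_derivative ((of_int k * \<i>) * exp (of_int k * Complex x y)) / (of_int k * \<i>))
        (at y within {-pi..pi})"
      unfolding G_def[abs_def] by (rule has_vector_derivative_divide)
    thus "(G has_vector_derivative exp (of_int k * Complex x y)) (at y within {-pi..pi})"
      using False by simp
  qed auto
  moreover have "G pi = G (-pi)"
  proof -
    have "of_int k * Complex x pi = of_int k * Complex x (-pi) + of_int (2 * k) * (of_real pi * \<i>)"
      by (simp add: Complex_eq algebra_simps)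
    hence "exp (of_int k * Complex x pi) = exp (of_int k * Complex x (-pi))"
      by (simp only: exp_integer_2pi_plus1 exp_add) (simp add: exp_eq_1)
    thus ?thesis by (simp add: G_def)
  qed
  ultimately show ?thesis using False by simp
qed

lemma distinct_partitions_eq:
  assumes "n \<le> N"
  shows "distinct_partitions n = {P \<in> Pow {1..N}. \<Sum>P = n}"
proof (intro equalityI subsetI)
  fix P assume "P \<in> distinct_partitions n"
  hence P: "finite P" "\<forall>k\<in>P. 0 < k" "\<Sum>P = n" by (auto simp: distinct_partitions_def)
  have "k \<le> N" if "k \<in> P" for k
    using member_le_sum[of k P "\<lambda>x. x"] P that assms by simp
  thus "P \<in> {P \<in> Pow {1..N}. \<Sum>P = n}" using P by (auto simp: Suc_le_eq)
next
  fix P assume "P \<in> {P \<in> Pow {1..N}. \<Sum>P = n}"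
  thus "P \<in> distinct_partitions n"
    by (auto simp: distinct_partitions_def Suc_le_eq intro: finite_subset)
qed

text \<open>The generating function restricted to parts at most N. Writing it with
  \<open>log1p_exp\<close> and \<open>fermi\<close> reduces the limit in N to that of two convergent
  series.\<close>

definition partial_gf :: "nat \<Rightarrow> nat \<Rightarrow> nat \<Rightarrow> complex \<Rightarrow> complex" where
  "partial_gf r t N z = exp (\<Sum>l=1..N. log1p_exp (of_nat l * z))
     * (\<Sum>m=1..N. if [m = r] (mod t) then fermi (of_nat m * z) else 0)"

lemma partial_gf_eq:
  assumes "0 < Re z"
  shows "partial_gf r t N z = (\<Sum>P\<in>Pow {1..N}. of_nat (card {k\<in>P. [k = r] (mod t)}) * exp (- of_nat (\<Sum>P) * z))"
proof -
  define x where "x l = exp (- (of_nat l * z))" for l :: nat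
  have nz: "1 + x l \<noteq> 0" if "l \<in> {1..N}" for l
    unfolding x_def using that assms by (intro one_plus_exp_nonzero) simp
  have x_fermi: "x m / (1 + x m) = fermi (of_nat m * z)" for m
    unfolding x_def fermi_def exp_minus by (simp add: divide_simps)
  have "(\<Sum>P\<in>Pow {1..N}. of_nat (card {k\<in>P. [k = r] (mod t)}) * exp (- of_nat (\<Sum>P) * z))
      = (\<Sum>P\<in>Pow {1..N}. of_nat (card {k\<in>P. [k = r] (mod t)}) * (\<Prod>l\<in>P. x l))"
  proof (intro sum.cong refl arg_cong2[where f = "(*)"])
    fix P assume "P \<in> Pow {1..N}"
    hence "finite P" using finite_subset by auto
    hence "(\<Prod>l\<in>P. x l) = exp (\<Sum>l\<in>P. - (of_nat l * z))" by (simp add: x_def exp_sum)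
    thus "exp (- of_nat (\<Sum>P) * z) = (\<Prod>l\<in>P. x l)" by (simp add: sum_negf sum_distrib_right)
  qed
  also have "\<dots> = (\<Prod>l\<in>{1..N}. 1 + x l) * (\<Sum>m\<in>{1..N}. if [m = r] (mod t) then x m / (1 + x m) else 0)"
    by (rule sum_Pow_card_prod) (use nz in auto)
  also have "(\<Prod>l\<in>{1..N}. 1 + x l) = exp (\<Sum>l=1..N. log1p_exp (of_nat l * z))"
    using nz by (simp add: exp_sum log1p_exp_def x_def)
  finally show ?thesis unfolding partial_gf_def x_fermi by (rule sym)
qed

text \<open>Orthogonality of the exponentials selects the sets with sum n. A part of such a set is
  at most n, so the value is the same for all N >= n.\<close>

lemma has_integral_partial_gf:
  assumes "0 < x" "n \<le> N"
  shows "((\<lambda>y. partial_gf r t N (Complex x y) * exp (of_nat n * Complex x y))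
      has_integral 2 * of_real pi * of_nat (D r t n)) {-pi..pi}"
proof -
  define c :: "nat set \<Rightarrow> complex" where "c P = of_nat (card {k\<in>P. [k = r] (mod t)})" for P
  have "((\<lambda>y. \<Sum>P\<in>Pow {1..N}. c P * exp (of_int (int n - int (\<Sum>P)) * Complex x y)) has_integral
      (\<Sum>P\<in>Pow {1..N}. c P * (if int n - int (\<Sum>P) = 0 then 2 * of_real pi else 0))) {-pi..pi}"
    by (intro has_integral_sum has_integral_mult_right has_integral_exp_circle) auto
  also have "(\<Sum>P\<in>Pow {1..N}. c P * (if int n - int (\<Sum>P) = 0 then 2 * of_real pi else 0))
      = (\<Sum>P\<in>Pow {1..N}. if \<Sum>P = n then 2 * of_real pi * c P else 0)"
    by (intro sum.cong refl) (auto simp del: of_nat_sum)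
  also have "\<dots> = (\<Sum>P\<in>distinct_partitions n. 2 * of_real pi * c P)"
    unfolding distinct_partitions_eq[OF assms(2)] by (rule sum.inter_filter[symmetric]) simp
  also have "\<dots> = 2 * of_real pi * of_nat (D r t n)"
    by (simp add: D_def c_def sum_distrib_left)
  also have "(\<lambda>y. \<Sum>P\<in>Pow {1..N}. c P * exp (of_int (int n - int (\<Sum>P)) * Complex x y))
      = (\<lambda>y. partial_gf r t N (Complex x y) * exp (of_nat n * Complex x y))"
  proof
    fix y
    have "exp (of_int (int n - int (\<Sum>P)) * Complex x y)
        = exp (- of_nat (\<Sum>P) * Complex x y) * exp (of_nat n * Complex x y)" for P :: "nat set"
      by (simp add: algebra_simps flip: exp_add)
    thus "(\<Sum>P\<in>Pow {1..N}. c P * exp (of_int (int n - int (\<Sum>P)) * Complex x y))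
      = partial_gf r t N (Complex x y) * exp (of_nat n * Complex x y)"
      using assms(1) by (subst partial_gf_eq) (simp_all add: c_def sum_distrib_right mult.assoc)
  qed
  finally show ?thesis .
qed

lemma tendsto_partial_gf:
  assumes "0 < Re z" "1 \<le> r" "r \<le> t"
  shows "(\<lambda>N. partial_gf r t N z) \<longlonglongrightarrow> exp (log_xi z) * fermi_arith_sum r t z"
proof -
  have "(\<lambda>N. \<Sum>k<N. log1p_exp (of_nat k * z + z)) \<longlonglongrightarrow> log_xi z"
    using sums_log_xi[OF assms(1)] by (simp add: sums_def)
  also have "(\<lambda>N. \<Sum>k<N. log1p_exp (of_nat k * z + z)) = (\<lambda>N. \<Sum>l=1..N. log1p_exp (of_nat l * z))"
    by (intro ext sum.reindex_bij_witness[of _ "\<lambda>l. l - 1" Suc]) (auto simp: algebra_simps)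
  finally have 1: "(\<lambda>N. \<Sum>l=1..N. log1p_exp (of_nat l * z)) \<longlonglongrightarrow> log_xi z" .
  \<comment> \<open>The condition \<open>0 < m\<close> matters for r = t, where 0 belongs to the
    residue class.\<close>
  define f where "f m = (if 0 < m \<and> [m = r] (mod t) then fermi (of_nat m * z) else 0)" for m
  have cong: "[k * t + r = r] (mod t)" for k by (simp add: cong_def)
  have "(\<lambda>k. f (k * t + r)) sums fermi_arith_sum r t z"
    using sums_fermi_arith_sum(1)[of z r t] assms cong by (simp add: f_def)
  also have "(\<lambda>k. f (k * t + r)) sums fermi_arith_sum r t z \<longleftrightarrow> f sums fermi_arith_sum r t z"
  proof (rule sums_mono_reindex)
    show "strict_mono (\<lambda>k. k * t + r)" using assms by (auto simp: strict_mono_def)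
    fix m assume m: "m \<notin> range (\<lambda>k. k * t + r)"
    show "f m = 0"
    proof (rule ccontr)
      assume "f m \<noteq> 0"
      hence *: "0 < m" "[m = r] (mod t)" by (auto simp: f_def split: if_splits)
      \<comment> \<open>Otherwise t would divide r - m, although 0 < r - m < t because of 0 < m and
        r <= t.\<close>
      have "r \<le> m"
      proof (rule ccontr)
        assume "\<not> r \<le> m"
        moreover from this *(2) have "t dvd r - m"
          using cong_altdef_nat[of m r t] by (simp add: cong_sym_eq)
        ultimately have "t \<le> r - m" by (intro dvd_imp_le) auto
        thus False using * assms by simp
      qed
      with *(2) have "t dvd m - r" by (simp add: cong_altdef_nat)
      then obtain k where "m - r = t * k" by blast
      hence "m = k * t + r" using \<open>r \<le> m\<close> by (simp add: mult.commute)
      thus False using m by blast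
    qed
  qed
  finally have "(\<lambda>N. \<Sum>m<Suc N. f m) \<longlonglongrightarrow> fermi_arith_sum r t z"
    unfolding sums_def by (rule LIMSEQ_Suc)
  also have "(\<lambda>N. \<Sum>m<Suc N. f m) = (\<lambda>N. \<Sum>m=1..N. if [m = r] (mod t) then fermi (of_nat m * z) else 0)"
  proof
    fix N
    have "(\<Sum>m<Suc N. f m) = (\<Sum>m\<in>{1..N}. f m)"
      by (intro sum.mono_neutral_right) (auto simp: f_def)
    also have "\<dots> = (\<Sum>m=1..N. if [m = r] (mod t) then fermi (of_nat m * z) else 0)"
      by (intro sum.cong) (auto simp: f_def)
    finally show "(\<Sum>m<Suc N. f m) = (\<Sum>m=1..N. if [m = r] (mod t) then fermi (of_nat m * z) else 0)" .
  qed
  finally have 2: "(\<lambda>N. \<Sum>m=1..N. if [m = r] (mod t) then fermi (of_nat m * z) else 0)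
      \<longlonglongrightarrow> fermi_arith_sum r t z" .
  show ?thesis
    unfolding partial_gf_def by (intro tendsto_intros 1 2)
qed

text \<open>A bound free of N and of Im z, as dominated convergence requires. At the real point Re z
  all logarithms are nonnegative, so their partial sums stay below the full series.\<close>

lemma norm_partial_gf_le:
  assumes "0 < Re z"
  shows "cmod (partial_gf r t N z) \<le> exp (Re (log_xi (of_real (Re z)))) * (4 / (Re z)\<^sup>2)"
proof -
  obtain s where s: "(\<lambda>k. 2 * exp (- (Re z / 2)) ^ Suc k / Re z) sums s" "s \<le> 4 / (Re z)\<^sup>2"
    using sums_fermi_majorant[OF assms] .
  have nonneg: "0 \<le> 2 * exp (- (Re z / 2)) ^ Suc k / Re z" for k using assms by simp
  have "cmod (\<Sum>m=1..N. if [m = r] (mod t) then fermi (of_nat m * z) else 0)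
      \<le> (\<Sum>m=1..N. 2 * exp (- (Re z / 2)) ^ Suc (m - 1) / Re z)"
  proof (rule sum_norm_le)
    fix m assume "m \<in> {1..N}"
    hence "m - 1 < m" by simp
    from norm_fermi_multiple_le[OF assms this] nonneg[of "m - 1"]
    show "cmod (if [m = r] (mod t) then fermi (of_nat m * z) else 0)
        \<le> 2 * exp (- (Re z / 2)) ^ Suc (m - 1) / Re z" by simp
  qed
  also have "\<dots> = (\<Sum>k<N. 2 * exp (- (Re z / 2)) ^ Suc k / Re z)"
    by (intro sum.reindex_bij_witness[of _ Suc "\<lambda>l. l - 1"]) auto
  also have "\<dots> \<le> s"
    using sum_le_suminf[OF sums_summable[OF s(1)], of "{..<N}"] nonneg sums_unique[OF s(1)] by simp
  finally have 2: "cmod (\<Sum>m=1..N. if [m = r] (mod t) then fermi (of_nat m * z) else 0) \<le> 4 / (Re z)\<^sup>2"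
    using s(2) by simp
  have R: "(\<lambda>k. Re (log1p_exp (of_nat k * of_real (Re z) + of_real (Re z)))) sums Re (log_xi (of_real (Re z)))"
    using assms by (intro sums_Re sums_log_xi) simp
  have real: "Re (log1p_exp (of_nat k * of_real (Re z) + of_real (Re z))) = ln (1 + exp (- (real (Suc k) * Re z)))" for k
  proof -
    have "of_nat k * of_real (Re z) + of_real (Re z) = complex_of_real (real (Suc k) * Re z)"
      by (simp add: algebra_simps)
    thus ?thesis by (simp only: log1p_exp_of_real Re_complex_of_real)
  qed
  have "Re (\<Sum>l=1..N. log1p_exp (of_nat l * z)) = (\<Sum>l=1..N. Re (log1p_exp (of_nat l * z)))" by simp
  also have "\<dots> \<le> (\<Sum>l=1..N. ln (1 + exp (- (real (Suc (l - 1)) * Re z))))"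
  proof (rule sum_mono)
    fix l assume l: "l \<in> {1..N}"
    define u where "u = of_nat l * z"
    have u: "0 < Re u" "Re u = real (Suc (l - 1)) * Re z" using l assms by (auto simp: u_def)
    have "Re (exp (- u)) \<le> exp (- Re u)" using complex_Re_le_cmod[of "exp (- u)"] by simp
    hence "0 \<le> (exp (- Re u) - Re (exp (- u))) / 4" by simp
    thus "Re (log1p_exp (of_nat l * z)) \<le> ln (1 + exp (- (real (Suc (l - 1)) * Re z)))"
      using Re_log1p_exp_le[OF u(1)] unfolding u(2)[symmetric] u_def[symmetric] by linarith
  qed
  also have "\<dots> = (\<Sum>k<N. ln (1 + exp (- (real (Suc k) * Re z))))"
    by (intro sum.reindex_bij_witness[of _ Suc "\<lambda>l. l - 1"]) auto
  also have "\<dots> \<le> Re (log_xi (of_real (Re z)))"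
    using sum_le_suminf[OF sums_summable[OF R], of "{..<N}"] sums_unique[OF R]
    by (simp add: real)
  finally have "cmod (exp (\<Sum>l=1..N. log1p_exp (of_nat l * z))) \<le> exp (Re (log_xi (of_real (Re z))))"
    by simp
  thus ?thesis
    unfolding partial_gf_def norm_mult using 2 by (intro mult_mono) auto
qed

text \<open>All truncated integrals with bound n + N have the same value, which the limit integrand
  inherits.\<close>

lemma has_integral_D:
  assumes "0 < x" "1 \<le> r" "r \<le> t"
  shows "((\<lambda>y. exp (log_xi (Complex x y)) * fermi_arith_sum r t (Complex x y) * exp (of_nat n * Complex x y))
      has_integral 2 * of_real pi * of_nat (D r t n)) {-pi..pi}"
proof (rule has_integral_dominated_convergence)
  show "((\<lambda>y. partial_gf r t (n + N) (Complex x y) * exp (of_nat n * Complex x y))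
      has_integral 2 * of_real pi * of_nat (D r t n)) {-pi..pi}" for N
    by (rule has_integral_partial_gf) (use assms in auto)
  show "(\<lambda>y. exp (Re (log_xi (of_real x))) * (4 / x\<^sup>2) * exp (real n * x)) integrable_on {-pi..pi}"
    by (rule integrable_const_ivl)
  show "\<forall>y\<in>{-pi..pi}. cmod (partial_gf r t (n + N) (Complex x y) * exp (of_nat n * Complex x y))
      \<le> exp (Re (log_xi (of_real x))) * (4 / x\<^sup>2) * exp (real n * x)" for N
  proof
    fix y
    have "cmod (partial_gf r t (n + N) (Complex x y)) \<le> exp (Re (log_xi (of_real x))) * (4 / x\<^sup>2)"
      using norm_partial_gf_le[of "Complex x y" r t "n + N"] assms by simp
    thus "cmod (partial_gf r t (n + N) (Complex x y) * exp (of_nat n * Complex x y))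
      \<le> exp (Re (log_xi (of_real x))) * (4 / x\<^sup>2) * exp (real n * x)"
      unfolding norm_mult by (intro mult_mono) auto
  qed
  show "\<forall>y\<in>{-pi..pi}. (\<lambda>N. partial_gf r t (n + N) (Complex x y) * exp (of_nat n * Complex x y))
      \<longlonglongrightarrow> exp (log_xi (Complex x y)) * fermi_arith_sum r t (Complex x y) * exp (of_nat n * Complex x y)"
  proof
    fix y
    have "(\<lambda>N. partial_gf r t (N + n) (Complex x y)) \<longlonglongrightarrow> exp (log_xi (Complex x y)) * fermi_arith_sum r t (Complex x y)"
      using tendsto_partial_gf[of "Complex x y" r t] assms by (intro LIMSEQ_ignore_initial_segment) simp
    thus "(\<lambda>N. partial_gf r t (n + N) (Complex x y) * exp (of_nat n * Complex x y))
      \<longlonglongrightarrow> exp (log_xi (Complex x y)) * fermi_arith_sum r t (Complex x y) * exp (of_nat n * Complex x y)"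
      by (intro tendsto_mult_right) (simp add: add.commute)
  qed
qed simp

subsection \<open>The error estimate\<close>

definition saddle_exp :: "nat \<Rightarrow> complex \<Rightarrow> complex" where
  "saddle_exp n z = exp (of_real (pi\<^sup>2) / (12 * z) + (of_nat n + 1 / 24) * z)"

text \<open>On the segment z = eta + i y, so dz = i dy and the i in the denominator of
  \<open>V\<close> cancels.\<close>

lemma has_integral_V:
  assumes "n > 0"
  shows "((\<lambda>y. Complex (eta n) y powi (int s - 1) * saddle_exp n (Complex (eta n) y)) has_integral
      2 * of_real pi * of_real (sqrt 2) * V s n) {-10 * eta n..10 * eta n}"
proof -
  have eta: "eta n > 0" using assms by (simp add: eta_def)
  let ?g = "\<lambda>z. z powi (int s - 1) * saddle_exp n z"
  have nz: "Complex (eta n) y \<noteq> 0" for y using eta by (simp add: complex_eq_iff)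
  have cont: "continuous_on {-10 * eta n..10 * eta n} (\<lambda>y. Complex (eta n) y)"
    unfolding Complex_eq by (intro continuous_intros)
  have "continuous_on {-10 * eta n..10 * eta n} (\<lambda>y. ?g (Complex (eta n) y))"
    unfolding saddle_exp_def using nz by (intro continuous_intros cont) auto
  hence "(\<lambda>y. ?g (Complex (eta n) y)) integrable_on {-10 * eta n..10 * eta n}"
    by (rule integrable_continuous_real)
  hence I: "((\<lambda>y. ?g (Complex (eta n) y)) has_integral
      integral {-10 * eta n..10 * eta n} (\<lambda>y. ?g (Complex (eta n) y))) {-10 * eta n..10 * eta n}"
    by (rule integrable_integral)
  have "contour_integral (D0_path n) ?g
      = \<i> * integral {-10 * eta n..10 * eta n} (\<lambda>y. ?g (Complex (eta n) y))"
    unfolding D0_path_def using eta by (intro contour_integral_linepath_same_Re) auto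
  hence "integral {-10 * eta n..10 * eta n} (\<lambda>y. ?g (Complex (eta n) y))
      = 2 * of_real pi * of_real (sqrt 2) * V s n"
    unfolding V_def saddle_exp_def by simp
  thus ?thesis using I by simp
qed

definition main_terms :: "nat \<Rightarrow> nat \<Rightarrow> nat \<Rightarrow> complex" where
  "main_terms r t n = of_real (ln 2 / real t) * V 0 n
           - of_real (1 / 2 * bernpoly 1 (real r / real t)) * V 1 n
           + of_real (real t / 8 * bernpoly 2 (real r / real t)) * V 2 n
           - of_real (real t ^ 3 / 192 * bernpoly 4 (real r / real t)) * V 4 n"

lemma has_integral_main_terms:
  assumes "n > 0" "t > 0"
  shows "((\<lambda>y. fermi_main (real r / real t) (of_nat t * Complex (eta n) y) * saddle_exp n (Complex (eta n) y)
      / of_real (sqrt 2)) has_integral 2 * of_real pi * main_terms r t n) {-10 * eta n..10 * eta n}"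
proof -
  define c0 c1 c2 c4 where "c0 = complex_of_real (ln 2 / real t)"
    and "c1 = complex_of_real (1 / 2 * bernpoly 1 (real r / real t))"
    and "c2 = complex_of_real (real t / 8 * bernpoly 2 (real r / real t))"
    and "c4 = complex_of_real (real t ^ 3 / 192 * bernpoly 4 (real r / real t))"
  define I where "I s = 2 * of_real pi * of_real (sqrt 2) * V s n" for s
  define g where "g s y = Complex (eta n) y powi (int s - 1) * saddle_exp n (Complex (eta n) y)" for s y
  have g: "(g s has_integral I s) {-10 * eta n..10 * eta n}" for s
    unfolding g_def I_def by (rule has_integral_V[OF assms(1)])
  have "((\<lambda>y. (c0 * g 0 y - c1 * g 1 y + c2 * g 2 y - c4 * g 4 y) / of_real (sqrt 2)) has_integral
      (c0 * I 0 - c1 * I 1 + c2 * I 2 - c4 * I 4) / of_real (sqrt 2)) {-10 * eta n..10 * eta n}"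
    by (intro has_integral_divide has_integral_diff has_integral_add has_integral_mult_right g)
  also have "(c0 * I 0 - c1 * I 1 + c2 * I 2 - c4 * I 4) / of_real (sqrt 2) = 2 * of_real pi * main_terms r t n"
    unfolding I_def main_terms_def c0_def[symmetric] c1_def[symmetric] c2_def[symmetric] c4_def[symmetric]
    by (simp add: field_simps)
  also have "(\<lambda>y. (c0 * g 0 y - c1 * g 1 y + c2 * g 2 y - c4 * g 4 y) / of_real (sqrt 2))
      = (\<lambda>y. fermi_main (real r / real t) (of_nat t * Complex (eta n) y) * saddle_exp n (Complex (eta n) y)
      / of_real (sqrt 2))"
  proof
    fix y
    define z where "z = Complex (eta n) y"
    have z: "z \<noteq> 0" using assms by (simp add: z_def complex_eq_iff eta_def)
    have "c0 * g 0 y - c1 * g 1 y + c2 * g 2 y - c4 * g 4 y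
        = (c0 / z - c1 + c2 * z - c4 * z ^ 3) * saddle_exp n z"
      by (simp add: g_def z_def[symmetric] ring_distribs divide_inverse)
    \<comment> \<open>The denominators 8 and 192 are 4 * 2! and 8 * 4!; the powers of t come from w
      = t z.\<close>
    also have "c0 / z - c1 + c2 * z - c4 * z ^ 3 = fermi_main (real r / real t) (of_nat t * z)"
      using assms z unfolding c0_def c1_def c2_def c4_def fermi_main_def
      by (simp add: fact_numeral power_mult_distrib mult_ac)
    finally show "(c0 * g 0 y - c1 * g 1 y + c2 * g 2 y - c4 * g 4 y) / of_real (sqrt 2)
        = fermi_main (real r / real t) (of_nat t * Complex (eta n) y) * saddle_exp n (Complex (eta n) y)
          / of_real (sqrt 2)" by (simp add: z_def)
  qed
  finally show ?thesis .
qed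

lemma norm_saddle_exp:
  "cmod (saddle_exp n (Complex x y)) = exp (pi\<^sup>2 / 12 * (x / (x\<^sup>2 + y\<^sup>2)) + (real n + 1 / 24) * x)"
proof -
  have "of_real (pi\<^sup>2) / (12 * z) = of_real (pi\<^sup>2 / 12) * inverse z" for z :: complex
    by (cases "z = 0") (simp_all add: field_simps)
  moreover have "of_nat n + 1 / 24 = complex_of_real (real n + 1 / 24)" by simp
  ultimately have "of_real (pi\<^sup>2) / (12 * Complex x y) + (of_nat n + 1 / 24) * Complex x y
      = of_real (pi\<^sup>2 / 12) * inverse (Complex x y) + of_real (real n + 1 / 24) * Complex x y"
    by (simp only:)
  hence "Re (of_real (pi\<^sup>2) / (12 * Complex x y) + (of_nat n + 1 / 24) * Complex x y)
      = Re (of_real (pi\<^sup>2 / 12) * inverse (Complex x y) + of_real (real n + 1 / 24) * Complex x y)"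
    by (rule arg_cong)
  also have "\<dots> = pi\<^sup>2 / 12 * (x / (x\<^sup>2 + y\<^sup>2)) + (real n + 1 / 24) * x"
    by simp
  finally show ?thesis unfolding saddle_exp_def norm_exp_eq_Re by simp
qed

text \<open>For |w| <= 1 the three terms after ln 2 / w contribute at most 1/4 + 1/48 + 1/40 <
  3/10.\<close>

lemma norm_fermi_main_le:
  assumes "0 \<le> a" "a \<le> 1" "w \<noteq> 0" "cmod w \<le> 1"
  shows "cmod (fermi_main a w) \<le> ln 2 / cmod w + 3 / 10"
proof -
  define b where "b j = bernpoly j a / fact j" for j
  note b = bernpoly_scaled_bounds[OF assms(1,2), folded b_def]
  have "cmod (fermi_main a w) \<le> cmod (of_real (ln 2) / w) + cmod (of_real (b 1) / 2)
      + cmod (of_real (b 2) * w / 4) + cmod (of_real (b 4) * w ^ 3 / 8)"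
    unfolding fermi_main_def b_def
    by (intro order_trans[OF norm_triangle_ineq4] add_mono order_trans[OF norm_triangle_ineq] order_refl)
  also have "cmod (of_real (ln 2) / w) = ln 2 / cmod w" by (simp add: norm_divide)
  also have "cmod (of_real (b 1) / 2) \<le> 1 / 4" using b(1) by (simp add: norm_divide)
  also have "cmod (of_real (b 2) * w / 4) \<le> 1 / 12 * 1 / 4"
    unfolding norm_divide norm_mult using b(2) assms(4) by (intro divide_mono mult_mono) auto
  also have "cmod (of_real (b 4) * w ^ 3 / 8) \<le> 1 / 5 * 1 / 8"
    unfolding norm_divide norm_mult norm_power using b(4) assms(4)
    by (intro divide_mono mult_mono power_le_one) auto
  finally show ?thesis by simp
qed

lemma norm_exp_minus_1_le:
  assumes "cmod w \<le> 1 / 2"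
  shows "cmod (exp w - 1) \<le> 2 * cmod w"
proof -
  have "cmod (exp w - 1) \<le> exp \<bar>Re w\<bar> * cmod w" using Taylor_exp[of w 0] by simp
  also have "exp \<bar>Re w\<bar> \<le> exp (1 / 2)" using assms abs_Re_le_cmod[of w] by simp
  also have "exp (1 / 2 :: real) \<le> 2"
    using exp_bound_half[of "1 / 2 :: real"] by simp
  finally show ?thesis by (simp add: mult_right_mono)
qed

text \<open>The saddle point identities for eta; the last two equations rewrite the exponents of the
  major and minor arcs in the form they have in \<open>Err\<close>.\<close>

lemma eta_facts:
  assumes "t \<ge> 2" "real n > 400 * real t ^ 2 / 3"
  shows "n > 0" "eta n > 0" "real t * eta n \<le> 4 / 50" "eta n \<le> 1 / 25"
    "(eta n)\<^sup>2 = pi\<^sup>2 / (12 * real n)"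
    "pi\<^sup>2 / (12 * eta n) = real n * eta n"
    "2 * real n * eta n = pi * sqrt (real n / 3)"
    "3 / (4 * eta n) + real n * eta n = (3 * sqrt 3 / (2 * pi) + pi / sqrt 12) * sqrt (real n)"
proof -
  have n: "real n > 0" by (rule le_less_trans[OF _ assms(2)]) simp
  thus "n > 0" by simp
  show eta: "eta n > 0" using n by (simp add: eta_def)
  show sq: "(eta n)\<^sup>2 = pi\<^sup>2 / (12 * real n)" using n by (simp add: eta_def power_divide)
  have "(real t * eta n)\<^sup>2 = real t ^ 2 * pi\<^sup>2 / (12 * real n)"
    unfolding power_mult_distrib sq by simp
  also have "\<dots> \<le> real t ^ 2 * pi\<^sup>2 / (12 * (400 * real t ^ 2 / 3))"
    using assms n by (intro divide_left_mono) auto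
  also have "\<dots> = (pi / 40)\<^sup>2" using assms by (simp add: power_divide)
  finally have "real t * eta n \<le> pi / 40" by (rule power2_le_imp_le) simp
  also have "pi / 40 \<le> 4 / 50" using pi_approx(2) by simp
  finally show te: "real t * eta n \<le> 4 / 50" .
  have "2 * eta n \<le> real t * eta n" using assms eta by (intro mult_right_mono) auto
  thus "eta n \<le> 1 / 25" using te by simp
  have "pi\<^sup>2 = 12 * real n * (eta n)\<^sup>2" using sq n by simp
  thus "pi\<^sup>2 / (12 * eta n) = real n * eta n" using eta by (simp add: power2_eq_square)
  have s12: "sqrt (12 * real n) = 2 * sqrt 3 * sqrt (real n)" "sqrt 12 = 2 * sqrt (3 :: real)"
  proof -
    have "sqrt (12 :: real) = sqrt (2\<^sup>2 * 3)" by simp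
    thus s: "sqrt 12 = 2 * sqrt (3 :: real)" by (simp only: real_sqrt_mult real_sqrt_power) simp
    show "sqrt (12 * real n) = 2 * sqrt 3 * sqrt (real n)" by (simp only: real_sqrt_mult s)
  qed
  define a b where "a = sqrt (3 :: real)" and "b = sqrt (real n)"
  have a: "a > 0" "a * a = 3" and b: "b > 0" "real n = b * b" using n by (auto simp: a_def b_def)
  have e: "eta n = pi / (2 * a * b)" by (simp add: eta_def s12 a_def b_def)
  have ne: "real n * eta n = pi / (2 * a) * b" unfolding e using a b by simp
  show "2 * real n * eta n = pi * sqrt (real n / 3)"
    using ne by (simp add: real_sqrt_divide a_def b_def)
  have "3 / (4 * eta n) = 3 * a / (2 * pi) * b" unfolding e by simp
  thus "3 / (4 * eta n) + real n * eta n = (3 * sqrt 3 / (2 * pi) + pi / sqrt 12) * sqrt (real n)"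
    unfolding ne s12 a_def[symmetric] b_def[symmetric] by (simp add: distrib_right)
qed

section \<open>Arc estimates and their assembly for fixed r, t, n\<close>

context
  fixes r t n :: nat and \<eta> :: real
  assumes t: "t \<ge> 2" and r: "1 \<le> r" "r \<le> t" and n: "real n > 400 * real t ^ 2 / 3"
  defines "\<eta> \<equiv> eta n"
begin

lemmas eta' = eta_facts[OF t n, folded \<eta>_def]

definition circle_integrand :: "real \<Rightarrow> complex" where
  "circle_integrand y = exp (log_xi (Complex \<eta> y)) * fermi_arith_sum r t (Complex \<eta> y) * exp (of_nat n * Complex \<eta> y)"

definition main_integrand :: "real \<Rightarrow> complex" where
  "main_integrand y = fermi_main (real r / real t) (of_nat t * Complex \<eta> y) * saddle_exp n (Complex \<eta> y) / of_real (sqrt 2)"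

definition minor_exp :: real where
  "minor_exp = exp (3 / (4 * \<eta>) + real n * \<eta>)"

lemma circle_integrand_minor:
  assumes "\<eta> \<le> \<bar>y\<bar>" "\<bar>y\<bar> \<le> pi"
  shows "cmod (circle_integrand y) \<le> 4 / \<eta>\<^sup>2 * minor_exp"
proof -
  have "cmod (circle_integrand y) = exp (Re (log_xi (Complex \<eta> y))) * cmod (fermi_arith_sum r t (Complex \<eta> y)) * exp (real n * \<eta>)"
    by (simp add: circle_integrand_def norm_mult)
  also have "\<dots> \<le> exp (3 / (4 * \<eta>)) * (4 / \<eta>\<^sup>2) * exp (real n * \<eta>)"
    using sums_fermi_arith_sum(2)[of "Complex \<eta> y" r t] Re_log_xi_minor_arc[of \<eta> y] eta'(1-4) assms r t
    by (intro mult_mono) auto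
  finally show ?thesis by (simp add: minor_exp_def exp_add mult_ac)
qed

lemma norm_z_ge: "\<eta> \<le> cmod (Complex \<eta> y)"
  using complex_Re_le_cmod[of "Complex \<eta> y"] by simp

text \<open>From |z|^2 >= 2 eta^2 the singular part of the exponent is at most half its value at
  eta, that is at most 5/(12 eta). The distance to 3/(4 eta) is more than enough for eta/24.\<close>

lemma main_integrand_minor:
  assumes "\<eta> \<le> \<bar>y\<bar>" "\<bar>y\<bar> \<le> 10 * \<eta>"
  shows "cmod (main_integrand y) \<le> 1 / (2 * \<eta>) * minor_exp"
proof -
  define w where "w = of_nat t * Complex \<eta> y"
  have w: "cmod w = real t * cmod (Complex \<eta> y)" by (simp add: w_def norm_mult)
  have "cmod (Complex \<eta> y) \<le> \<bar>\<eta>\<bar> + \<bar>y\<bar>" using cmod_le[of "Complex \<eta> y"] by simp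
  \<comment> \<open>With t eta <= 4/50 this is at most 0.88, so the bound for
    \<open>fermi_main\<close> applies up to height 10 eta.\<close>
  hence "cmod w \<le> real t * (11 * \<eta>)" unfolding w using assms eta'(1-4) by (intro mult_left_mono) auto
  hence w1: "cmod w \<le> 1" using eta'(1-4) by simp
  have wge: "2 * \<eta> \<le> cmod w" unfolding w using t norm_z_ge eta'(1-4) by (intro mult_mono) auto
  hence w0: "w \<noteq> 0" using eta'(1-4) by auto
  have "cmod (fermi_main (real r / real t) w) \<le> ln 2 / cmod w + 3 / 10"
    by (rule norm_fermi_main_le) (use r t w0 w1 in auto)
  also have "\<dots> \<le> 7 / 10 / (2 * \<eta>) + 3 / 10"
    using wge eta'(1-4) ln2_le_25_over_36 by (intro add_right_mono frac_le) auto
  also have "\<dots> \<le> 1 / (2 * \<eta>)" using eta'(1-4) by (simp add: field_simps)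
  finally have P: "cmod (fermi_main (real r / real t) w) \<le> 1 / (2 * \<eta>)" .
  have E: "cmod (saddle_exp n (Complex \<eta> y)) \<le> minor_exp"
  proof -
    have "\<eta>\<^sup>2 \<le> y\<^sup>2" using assms eta'(1-4) abs_le_square_iff[of \<eta> y] by simp
    hence "\<eta> / (\<eta>\<^sup>2 + y\<^sup>2) \<le> \<eta> / (2 * \<eta>\<^sup>2)"
      using eta'(2) by (intro divide_left_mono mult_pos_pos add_pos_nonneg) auto
    also have "\<dots> = 1 / (2 * \<eta>)" using eta'(1-4) by (simp add: power2_eq_square)
    finally have "pi\<^sup>2 / 12 * (\<eta> / (\<eta>\<^sup>2 + y\<^sup>2)) \<le> 10 / 12 * (1 / (2 * \<eta>))"
      using pi_squared_bounds eta'(1-4) by (intro mult_mono) auto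
    moreover have "\<eta> / 24 \<le> 1 / (4 * \<eta>)"
    proof -
      have "\<eta> * \<eta> \<le> 1 * 1" using eta'(1-4) by (intro mult_mono) auto
      thus ?thesis using eta'(1-4) by (simp add: field_simps)
    qed
    moreover have "10 / 12 * (1 / (2 * \<eta>)) + 1 / (4 * \<eta>) \<le> 3 / (4 * \<eta>)"
      using eta'(1-4) by (simp add: field_simps)
    ultimately show ?thesis
      unfolding norm_saddle_exp minor_exp_def by (simp add: algebra_simps)
  qed
  have "cmod (main_integrand y) = cmod (fermi_main (real r / real t) w) * cmod (saddle_exp n (Complex \<eta> y)) / sqrt 2"
    by (simp add: main_integrand_def w_def norm_mult norm_divide)
  also have "\<dots> \<le> (1 / (2 * \<eta>)) * minor_exp / 1"
    using P E eta'(1-4) by (intro divide_mono mult_mono) (auto simp: minor_exp_def)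
  finally show ?thesis by simp
qed

text \<open>Both integrands share the factor \<open>saddle_exp\<close> over sqrt 2. What remains is
  the difference of \<open>exp \<epsilon> * L\<close> and \<open>P\<close>, split into
  \<open>(exp \<epsilon> - 1) * L\<close> and \<open>L - P\<close>. The constants are 1600 = 2 * 100
  * 8 and 55200 = 9200 * 6.\<close>

lemma major_arc:
  assumes "\<bar>y\<bar> \<le> \<eta>"
  shows "cmod (circle_integrand y - main_integrand y)
    \<le> 101 / 100 * exp (2 * real n * \<eta>) * (1600 * \<eta> ^ 6 / (real t * \<eta>) + 55200 * (real t * \<eta>) ^ 5)"
proof -
  define z where "z = Complex \<eta> y"
  define w where "w = of_nat t * z"
  define T where "T = real t * \<eta>"
  have T: "0 < T" "T \<le> 4 / 50" using eta'(1-4) t by (auto simp: T_def)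
  have z: "0 < Re z" "\<bar>Im z\<bar> \<le> Re z" using assms eta'(1-4) by (auto simp: z_def)
  have w_sector: "0 < Re w" "\<bar>Im w\<bar> \<le> Re w"
    using z t by (auto simp: w_def abs_mult)
  have z2: "(cmod z)\<^sup>2 \<le> 2 * \<eta>\<^sup>2"
  proof -
    have "y\<^sup>2 \<le> \<eta>\<^sup>2" using assms eta'(1-4) abs_le_square_iff[of y \<eta>] by simp
    thus ?thesis by (simp add: z_def cmod_power2)
  qed
  have "(3 / 2 * \<eta>)\<^sup>2 = 9 / 4 * \<eta>\<^sup>2" by (simp add: power_mult_distrib power_divide)
  moreover have "0 \<le> \<eta>\<^sup>2" by simp
  ultimately have "(cmod z)\<^sup>2 \<le> (3 / 2 * \<eta>)\<^sup>2" using z2 by linarith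
  \<comment> \<open>3/2 is sqrt 2 rounded up. To lose little, the high powers below use |z|^2 <= 2
    eta^2 and spend 3/2 only on an odd factor; it also gives |w| <= 0.12 < 1/8.\<close>
  hence z32: "cmod z \<le> 3 / 2 * \<eta>" by (rule power2_le_imp_le) (use eta'(1-4) in auto)
  have z_ge: "\<eta> \<le> cmod z" unfolding z_def by (rule norm_z_ge)
  have wz: "cmod w = real t * cmod z" by (simp add: w_def norm_mult)
  have w_le: "cmod w \<le> 3 / 2 * T" unfolding wz T_def using z32 t by (simp add: mult_left_mono)
  have w_ge: "T \<le> cmod w" unfolding wz T_def using z_ge by (intro mult_left_mono) auto
  have w0: "w \<noteq> 0" using w_sector by auto
  have z6: "cmod z ^ 6 \<le> 8 * \<eta> ^ 6"
  proof -
    have "cmod z ^ 6 = ((cmod z)\<^sup>2) ^ 3" by (simp flip: power_mult)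
    also have "\<dots> \<le> (2 * \<eta>\<^sup>2) ^ 3" using z2 by (intro power_mono) auto
    also have "\<dots> = 8 * \<eta> ^ 6" by (simp add: power_mult_distrib flip: power_mult)
    finally show ?thesis .
  qed
  have w5: "cmod w ^ 5 \<le> 6 * T ^ 5"
  proof -
    have "(cmod w)\<^sup>2 \<le> 2 * T\<^sup>2"
      unfolding wz T_def power_mult_distrib using mult_left_mono[OF z2, of "(real t)\<^sup>2"] by (simp add: mult_ac)
    hence "((cmod w)\<^sup>2)\<^sup>2 * cmod w \<le> (2 * T\<^sup>2)\<^sup>2 * (3 / 2 * T)"
      using w_le T by (intro mult_mono power_mono) auto
    thus ?thesis by (simp add: eval_nat_numeral mult_ac)
  qed
  define \<epsilon> where "\<epsilon> = log_xi z - (of_real (pi\<^sup>2) / (12 * z) - of_real (ln 2 / 2) + z / 24)"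
  have "cmod \<epsilon> \<le> 100 * cmod z ^ 6"
    unfolding \<epsilon>_def using z z32 eta'(1-4) by (intro log_xi_expansion) auto
  also have "\<dots> \<le> 800 * \<eta> ^ 6" using z6 by simp
  finally have \<epsilon>: "cmod \<epsilon> \<le> 800 * \<eta> ^ 6" .
  have "\<eta> ^ 6 \<le> (1 / 25) ^ 6" using eta'(1-4) by (intro power_mono) auto
  also have "\<dots> \<le> (1 / 1600 :: real)" by (simp add: power_divide)
  finally have \<epsilon>_half: "cmod \<epsilon> \<le> 1 / 2" using \<epsilon> by simp
  have e: "cmod (exp \<epsilon> - 1) \<le> 1600 * \<eta> ^ 6"
    using norm_exp_minus_1_le[OF \<epsilon>_half] \<epsilon> by simp
  define P where "P = fermi_main (real r / real t) w"
  define L where "L = fermi_arith_sum r t z"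
  have LP: "cmod (L - P) \<le> 55200 * T ^ 5"
  proof -
    have "cmod (L - P) \<le> 9200 * cmod w ^ 5"
      unfolding L_def P_def w_def using w_sector w_le T r t
      by (subst fermi_arith_sum_eq) (auto intro!: fermi_sum_expansion simp: w_def[symmetric])
    thus ?thesis using w5 by simp
  qed
  have L: "cmod L \<le> 1 / T"
  proof -
    have "cmod L \<le> cmod P + cmod (L - P)" using norm_triangle_ineq[of P "L - P"] by simp
    also have "cmod P \<le> ln 2 / cmod w + 3 / 10"
      unfolding P_def by (rule norm_fermi_main_le) (use r t w0 w_le T in auto)
    also have "ln 2 / cmod w \<le> 7 / 10 / T"
      using w_ge T ln2_le_25_over_36 by (intro frac_le) auto
    also have "cmod (L - P) \<le> 55200 * (4 / 50) ^ 5"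
    proof -
      have "T ^ 5 \<le> (4 / 50) ^ 5" using T by (intro power_mono) auto
      thus ?thesis using LP by linarith
    qed
    \<comment> \<open>The two constants add up to less than 1/2, while T <= 4/50 makes the spare
      3/(10 T) at least 3.75.\<close>
    also have "7 / 10 / T + 3 / 10 + 55200 * (4 / 50) ^ 5 \<le> 1 / T"
      using T by (simp add: field_simps power_divide)
    finally show ?thesis by simp
  qed
  have E: "cmod (saddle_exp n z) \<le> 101 / 100 * exp (2 * real n * \<eta>)"
  proof -
    have "\<eta> / (\<eta>\<^sup>2 + y\<^sup>2) \<le> \<eta> / \<eta>\<^sup>2" using eta'(1-4) by (intro divide_left_mono mult_pos_pos add_pos_nonneg) auto
    hence "pi\<^sup>2 / 12 * (\<eta> / (\<eta>\<^sup>2 + y\<^sup>2)) \<le> pi\<^sup>2 / 12 * (1 / \<eta>)"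
      using eta'(1-4) by (intro mult_left_mono) (auto simp: power2_eq_square)
    also have "\<dots> = real n * \<eta>" using eta'(6) by simp
    finally have "cmod (saddle_exp n z) \<le> exp (\<eta> / 24 + 2 * real n * \<eta>)"
      unfolding z_def norm_saddle_exp by (simp add: algebra_simps)
    also have "\<dots> = exp (\<eta> / 24) * exp (2 * real n * \<eta>)" by (rule exp_add)
    also have "exp (\<eta> / 24) \<le> 101 / 100"
    proof -
      have "exp (\<eta> / 24) \<le> 1 + 2 * (\<eta> / 24)"
        using exp_bound_lemma[of "\<eta> / 24"] eta'(1-4) by simp
      also have "\<dots> \<le> 101 / 100" using eta'(1-4) by simp
      finally show ?thesis .
    qed
    finally show ?thesis by (simp add: mult_right_mono)
  qed
  have exp_half: "exp (complex_of_real (ln 2 / 2)) = of_real (sqrt 2)"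
  proof -
    have "sqrt (2 :: real) = exp (ln 2 / 2)"
      by (simp add: powr_half_sqrt[symmetric] powr_def)
    thus ?thesis by (simp only: exp_of_real)
  qed
  have xi: "exp (log_xi z) * exp (of_nat n * z) = saddle_exp n z / of_real (sqrt 2) * exp \<epsilon>"
  proof -
    have "log_xi z + of_nat n * z = (of_real (pi\<^sup>2) / (12 * z) + (of_nat n + 1 / 24) * z) - of_real (ln 2 / 2) + \<epsilon>"
      by (simp add: \<epsilon>_def algebra_simps)
    hence "exp (log_xi z + of_nat n * z)
        = exp ((of_real (pi\<^sup>2) / (12 * z) + (of_nat n + 1 / 24) * z) - of_real (ln 2 / 2) + \<epsilon>)"
      by (rule arg_cong)
    thus ?thesis unfolding exp_add exp_diff exp_half saddle_exp_def .
  qed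
  have "circle_integrand y - main_integrand y
      = saddle_exp n z / of_real (sqrt 2) * ((exp \<epsilon> - 1) * L + (L - P))"
  proof -
    define c where "c = saddle_exp n z / of_real (sqrt 2)"
    have "circle_integrand y = (exp (log_xi z) * exp (of_nat n * z)) * L"
      by (simp add: circle_integrand_def z_def L_def)
    moreover have "main_integrand y = c * P"
      by (simp add: main_integrand_def z_def w_def P_def c_def)
    moreover have "c * exp \<epsilon> * L - c * P = c * ((exp \<epsilon> - 1) * L + (L - P))"
      by (simp add: algebra_simps)
    ultimately show ?thesis unfolding xi c_def[symmetric] by (simp only:)
  qed
  hence "cmod (circle_integrand y - main_integrand y)
      = cmod (saddle_exp n z) / sqrt 2 * cmod ((exp \<epsilon> - 1) * L + (L - P))"
    by (simp add: norm_mult norm_divide)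
  also have "\<dots> \<le> (101 / 100 * exp (2 * real n * \<eta>)) / 1 * (1600 * \<eta> ^ 6 * (1 / T) + 55200 * T ^ 5)"
  proof (intro mult_mono divide_mono)
    have "cmod ((exp \<epsilon> - 1) * L + (L - P)) \<le> cmod (exp \<epsilon> - 1) * cmod L + cmod (L - P)"
      using norm_triangle_ineq norm_mult by metis
    also have "\<dots> \<le> 1600 * \<eta> ^ 6 * (1 / T) + 55200 * T ^ 5"
      using e L LP eta'(1-4) by (intro add_mono mult_mono) auto
    finally show "cmod ((exp \<epsilon> - 1) * L + (L - P)) \<le> 1600 * \<eta> ^ 6 * (1 / T) + 55200 * T ^ 5" .
  qed (use E in auto)
  finally show ?thesis by (simp add: T_def)
qed

text \<open>The integrand of the main terms is extended by zero to [-pi, pi], so that a single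
  difference is integrated. The majorant g is a sum of overlapping step functions: B2 is charged on
  the whole circle and B3 on the whole segment, which keeps its integral simple.\<close>

lemma circle_method_bound:
  assumes "0 \<le> B1" "0 \<le> B2" "0 \<le> B3"
    and B1: "\<And>y. \<bar>y\<bar> \<le> \<eta> \<Longrightarrow> cmod (circle_integrand y - main_integrand y) \<le> B1"
    and B2: "\<And>y. \<eta> \<le> \<bar>y\<bar> \<Longrightarrow> \<bar>y\<bar> \<le> pi \<Longrightarrow> cmod (circle_integrand y) \<le> B2"
    and B3: "\<And>y. \<eta> \<le> \<bar>y\<bar> \<Longrightarrow> \<bar>y\<bar> \<le> 10 * \<eta> \<Longrightarrow> cmod (main_integrand y) \<le> B3"
  shows "2 * pi * cmod (of_nat (D r t n) - main_terms r t n) \<le> 2 * \<eta> * B1 + 2 * pi * B2 + 20 * \<eta> * B3"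
proof -
  have sub: "{-10 * \<eta>..10 * \<eta>} \<subseteq> {-pi..pi}" "{-\<eta>..\<eta>} \<subseteq> {-pi..pi}" using eta'(1-4) pi_gt3 by auto
  have X: "(circle_integrand has_integral 2 * of_real pi * of_nat (D r t n)) {-pi..pi}"
    unfolding circle_integrand_def[abs_def] using has_integral_D[of \<eta> r t n] eta'(1-4) r by simp
  have Y: "((\<lambda>y. if y \<in> {-10 * \<eta>..10 * \<eta>} then main_integrand y else 0) has_integral
      2 * of_real pi * main_terms r t n) {-pi..pi}"
    unfolding has_integral_restrict[OF sub(1)] main_integrand_def[abs_def]
    using has_integral_main_terms[of n t r] eta'(1-4) t by (simp add: \<eta>_def)
  define f where "f y = circle_integrand y - (if y \<in> {-10 * \<eta>..10 * \<eta>} then main_integrand y else 0)" for y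
  have f: "(f has_integral 2 * of_real pi * (of_nat (D r t n) - main_terms r t n)) {-pi..pi}"
    unfolding f_def[abs_def] using has_integral_diff[OF X Y] by (simp add: algebra_simps)
  define g where "g y = (if y \<in> {-\<eta>..\<eta>} then B1 else 0) + B2 + (if y \<in> {-10 * \<eta>..10 * \<eta>} then B3 else 0)" for y
  have g: "(g has_integral (2 * \<eta> * B1 + 2 * pi * B2 + 20 * \<eta> * B3)) {-pi..pi}"
  proof -
    have 1: "((\<lambda>y. if y \<in> {-\<eta>..\<eta>} then B1 else 0) has_integral 2 * \<eta> * B1) {-pi..pi}"
      unfolding has_integral_restrict[OF sub(2)] using has_integral_const_real[of B1 "-\<eta>" \<eta>] eta'(1-4) by simp
    have 2: "((\<lambda>y. B2) has_integral 2 * pi * B2) {-pi..pi}"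
      using has_integral_const_real[of B2 "-pi" pi] by simp
    have 3: "((\<lambda>y. if y \<in> {-10 * \<eta>..10 * \<eta>} then B3 else 0) has_integral 20 * \<eta> * B3) {-pi..pi}"
      unfolding has_integral_restrict[OF sub(1)]
      using has_integral_const_real[of B3 "-10 * \<eta>" "10 * \<eta>"] eta'(1-4) by simp
    show ?thesis unfolding g_def[abs_def] by (intro has_integral_add 1 2 3)
  qed
  have "cmod (integral {-pi..pi} f) \<le> integral {-pi..pi} g"
  proof (rule Henstock_Kurzweil_Integration.integral_norm_bound_integral)
    show "f integrable_on {-pi..pi}" "g integrable_on {-pi..pi}" using f g by blast+
    fix y assume y: "y \<in> {-pi..pi}"
    show "cmod (f y) \<le> g y"
    proof (cases "\<bar>y\<bar> \<le> \<eta>")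
      case True
      hence "y \<in> {-\<eta>..\<eta>}" "y \<in> {-10 * \<eta>..10 * \<eta>}" using eta'(1-4) by auto
      thus ?thesis using B1[OF True] assms(1-3) unfolding f_def g_def by simp
    next
      case False
      hence X2: "cmod (circle_integrand y) \<le> B2" using y by (intro B2) auto
      show ?thesis
      proof (cases "\<bar>y\<bar> \<le> 10 * \<eta>")
        case True
        have "cmod (circle_integrand y - main_integrand y) \<le> B2 + B3"
          using norm_triangle_ineq4[of "circle_integrand y" "main_integrand y"] X2 B3[of y] False True
          by simp
        moreover have "y \<in> {-10 * \<eta>..10 * \<eta>}" using True by auto
        ultimately show ?thesis using assms(1-3) unfolding f_def g_def by simp
      next
        case False
        hence nin: "y \<notin> {-10 * \<eta>..10 * \<eta>}" "y \<notin> {-\<eta>..\<eta>}" using eta'(2) by auto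
        have "f y = circle_integrand y" "g y = B2"
          by (simp_all only: f_def g_def if_not_P[OF nin(1)] if_not_P[OF nin(2)]
              diff_zero add_0 add_0_right)
        thus ?thesis using X2 by simp
      qed
    qed
  qed
  thus ?thesis using f g by (simp add: integral_unique norm_mult)
qed

lemma error_bound: "cmod (of_nat (D r t n) - main_terms r t n) \<le> Err t n"
proof -
  define A where "A = exp (2 * real n * \<eta>)"
  define B1 where "B1 = 101 / 100 * A * (1600 * \<eta> ^ 6 / (real t * \<eta>) + 55200 * (real t * \<eta>) ^ 5)"
  have "2 * pi * cmod (of_nat (D r t n) - main_terms r t n)
      \<le> 2 * \<eta> * B1 + 2 * pi * (4 / \<eta>\<^sup>2 * minor_exp) + 20 * \<eta> * (1 / (2 * \<eta>) * minor_exp)"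
  proof (rule circle_method_bound)
    show "\<bar>y\<bar> \<le> \<eta> \<Longrightarrow> cmod (circle_integrand y - main_integrand y) \<le> B1" for y
      unfolding B1_def A_def by (rule major_arc)
    show "0 \<le> B1" using eta'(1-4) by (simp add: B1_def A_def)
    show "0 \<le> 4 / \<eta>\<^sup>2 * minor_exp" "0 \<le> 1 / (2 * \<eta>) * minor_exp" using eta'(1-4) by (simp_all add: minor_exp_def)
  qed (rule circle_integrand_minor main_integrand_minor; assumption)+
  hence "cmod (of_nat (D r t n) - main_terms r t n)
      \<le> \<eta> * B1 / pi + (4 / \<eta>\<^sup>2 * minor_exp + 5 / pi * minor_exp)"
    using eta'(1-4) by (simp add: field_simps)
  also have "\<eta> * B1 / pi \<le> 14381 * real t ^ 5 / real n ^ 3 * A"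
  proof -
    \<comment> \<open>From t >= 2. It merges both error terms into one multiple of t^5 eta^6, with
      55200 + 1600/64 = 55225.\<close>
    have t64: "1 / real t \<le> real t ^ 5 / 64"
    proof -
      have "(2 :: real) ^ 6 \<le> real t ^ 6" using t by (intro power_mono) auto
      thus ?thesis using t by (simp add: field_simps eval_nat_numeral)
    qed
    have \<eta>6: "\<eta> ^ 6 = pi ^ 6 / (1728 * real n ^ 3)"
    proof -
      have "\<eta> ^ 6 = (\<eta>\<^sup>2) ^ 3" by (simp flip: power_mult)
      also have "\<dots> = pi ^ 6 / (1728 * real n ^ 3)"
        unfolding eta'(5) by (simp add: power_divide power_mult_distrib flip: power_mult)
      finally show ?thesis .
    qed
    have "\<eta> * B1 = 101 / 100 * A * (1600 * (1 / real t) * \<eta> ^ 6 + 55200 * real t ^ 5 * \<eta> ^ 6)"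
      using eta'(1-4) t by (simp add: B1_def field_simps eval_nat_numeral)
    also have "\<dots> \<le> 101 / 100 * A * (1600 * (real t ^ 5 / 64) * \<eta> ^ 6 + 55200 * real t ^ 5 * \<eta> ^ 6)"
      using t64 eta'(1-4) by (intro mult_left_mono add_right_mono mult_right_mono) (auto simp: A_def)
    also have "\<dots> = 101 / 100 * 55225 * (real t ^ 5 * A) * \<eta> ^ 6" by (simp add: algebra_simps)
    finally have "\<eta> * B1 / pi \<le> 101 / 100 * 55225 * (real t ^ 5 * A) * \<eta> ^ 6 / pi"
      by (intro divide_right_mono) auto
    also have "\<dots> = (101 / 100 * 55225 / 1728 * pi ^ 5) * (real t ^ 5 * A / real n ^ 3)"
      unfolding \<eta>6 by (simp add: eval_nat_numeral)
    also have "\<dots> \<le> 14381 * (real t ^ 5 * A / real n ^ 3)"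
    proof (intro mult_right_mono)
      \<comment> \<open>With this bound the left constant is about 10011.\<close>
      have "pi ^ 5 \<le> 3.15 ^ 5" using pi_approx(2) by (intro power_mono) auto
      thus "101 / 100 * 55225 / 1728 * pi ^ 5 \<le> 14381" by (simp add: eval_nat_numeral)
    qed (simp add: A_def)
    finally show ?thesis by simp
  qed
  \<comment> \<open>Here 4/eta^2 = 48 n/pi^2 <= 16 n/3 and 5/pi <= 2 <= 2 n.\<close>
  also have "4 / \<eta>\<^sup>2 * minor_exp + 5 / pi * minor_exp \<le> 9 * real n * minor_exp"
  proof -
    have "1 \<le> real n" using eta'(1) by simp
    moreover have "5 / pi \<le> 2" using pi_gt3 by (simp add: field_simps)
    moreover have "4 / \<eta>\<^sup>2 = 48 * real n / pi\<^sup>2" unfolding eta'(5) by simp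
    moreover have "48 * real n / pi\<^sup>2 \<le> 48 * real n / 9"
      using pi_squared_bounds by (intro divide_left_mono) auto
    ultimately have "4 / \<eta>\<^sup>2 + 5 / pi \<le> 9 * real n" by simp
    hence "(4 / \<eta>\<^sup>2 + 5 / pi) * minor_exp \<le> 9 * real n * minor_exp"
      by (intro mult_right_mono) (auto simp: minor_exp_def)
    thus ?thesis by (simp add: distrib_right)
  qed
  finally have "cmod (of_nat (D r t n) - main_terms r t n)
      \<le> 14381 * real t ^ 5 / real n ^ 3 * A + 9 * real n * minor_exp" by simp
  also have "\<dots> \<le> Err t n"
    unfolding Err_def A_def minor_exp_def eta'(7,8) by simp
  finally show ?thesis .
qed

end

theorem theorem1p2:
  fixes r t n :: nat
  assumes "t \<ge> 2" and "1 \<le> r" and "r \<le> t"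
    and "real n > 400 * real t ^ 2 / 3"
  shows "cmod (of_nat (D r t n)
           - of_real (ln 2 / real t) * V 0 n
           + of_real (1 / 2 * bernpoly 1 (real r / real t)) * V 1 n
           - of_real (real t / 8 * bernpoly 2 (real r / real t)) * V 2 n
           + of_real (real t ^ 3 / 192 * bernpoly 4 (real r / real t)) * V 4 n)
         \<le> Err t n"
  using error_bound[OF assms] unfolding main_terms_def by (simp only: algebra_simps)

end
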